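(* Let $r,p$ be coprime odd integers with $1\le r<p$ and let $x=r/p$. Let $\sigma_2(x)$ denote the signature of the $\mathrm{SU}(2)$-TQFT associated with $x$ for a closed surface of genus $2$. Then $$\sigma_2(x)=\frac2p\sum_{\substack{1\le n\le p-2\\ n\text{ odd}}}\frac{\cot^3(\pi n/2p)}{\sin(\pi nx)}=p^2S_2^{\mathrm{odd}}(x)-2S_0^{\mathrm{odd}}(x)$$ $$=\lim_{\tau\to0}\left(p^2\,\frac{32}{\pi^3 i}\,E_{-2}^{\mathrm{odd}}(\tau+x)-\frac{8}{\pi i}\,E_0^{\mathrm{odd}}(\tau+x)-\frac{1}{3p^2\tau}\right),$$ where $\tau\to0$ nontangentially in the upper half plane (i.e. within a sector $\varepsilon\le\arg\tau\le\pi-\varepsilon$, for any fixed $0<\varepsilon<\pi/2$).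
   Context: For an even integer $g\ge0$ and $x=r/p$ as in the claim, $$S_g^{\mathrm{odd}}(x)=\frac{1}{p^{g+1}}\sum_{\substack{1\le n\le p-2\\ n\text{ odd}}}\frac{\cot^{(g)}(\pi n/2p)}{\sin(\pi nx)}\in\mathbb{Q},$$ where $\cot^{(g)}$ is the $g$-th derivative of $\cot$. For $\tau$ in the upper half plane, $$E_{-g}^{\mathrm{odd}}(\tau)=\sum_{n\ge1,\ n\text{ odd}}\sigma_{-g-1}(n)\,e^{\pi i n\tau},\qquad \sigma_{-g-1}(n)=\sum_{0<d\mid n}d^{-g-1}.$$ For coprime odd integers $1\le r<p$ and $x=r/p$, $\sigma_2(x)\in\mathbb{Z}$ is the signature of the Hermitian form on the vector space attached to a closed surface of genus $2$ by the $\mathrm{SU}(2)$-TQFT determined by $r/p$ (in the sense of Deroin--Marché). The only information about $\sigma_2$ used is the following known formula of Marché--Masbaum, which may be taken as the definition of $\sigma_2(x)$: $$\sigma_2(x)=\frac{1}{6p^2}-\frac16+\frac{1}{4p^2}\sum_{\substack{1\le n\le p-2\\ n\text{ odd}}}\frac{T(n;x)}{\sin^3(\pi n/2p)\,\sin^2(\pi n x)},$$ $$T(n;x)=\sum_{\varepsilon\in\{\pm1\}}(p+\varepsilon)\left(\sin\left(\frac{\pi(2r-3\varepsilon)n}{2p}\right)+3\sin\left(\frac{\pi(2r+\varepsilon)n}{2p}\right)\right).$$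
   Formalization: The limit as printed is false for every r, p: the E_0^odd term contributes an extra imaginary constant, so the limit is proved to equal σ_2(x) + 2i ln(2)/π instead of σ_2(x) (its real part is σ_2(x)). *)

theory Defs
  imports "HOL-Analysis.Analysis"
begin

definition odds_upto :: "int \<Rightarrow> int set" where
  "odds_upto m = {n. 1 \<le> n \<and> n \<le> m \<and> odd n}"

text \<open>
  The parameter \<open>x = r/p\<close> is carried as the pair of integers \<open>r\<close>, \<open>p\<close>, since the sums below depend
  on the denominator \<open>p\<close> of the reduced fraction.
\<close>

definition T_sum :: "int \<Rightarrow> int \<Rightarrow> int \<Rightarrow> real" where
  "T_sum r p n =
     (\<Sum>\<epsilon>\<in>{1, -1::real}. (real_of_int p + \<epsilon>) *
        (sin (pi * (2 * real_of_int r - 3 * \<epsilon>) * real_of_int n / (2 * real_of_int p))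
         + 3 * sin (pi * (2 * real_of_int r + \<epsilon>) * real_of_int n / (2 * real_of_int p))))"

text \<open>
  The genus-2 signature of the SU(2)-TQFT attached to \<open>r/p\<close>, introduced through the
  Marche--Masbaum formula.
\<close>

definition sigma2 :: "int \<Rightarrow> int \<Rightarrow> real" where
  "sigma2 r p =
     1 / (6 * real_of_int p ^ 2) - 1 / 6
     + 1 / (4 * real_of_int p ^ 2) *
       (\<Sum>n\<in>odds_upto (p - 2).
          T_sum r p n /
          (sin (pi * real_of_int n / (2 * real_of_int p)) ^ 3
           * sin (pi * real_of_int n * (real_of_int r / real_of_int p)) ^ 2))"

text \<open>\<open>S_odd g r p\<close> is \<open>S\<^sub>g\<^sup>o\<^sup>d\<^sup>d(r/p)\<close>; only even \<open>g\<close> are of interest.\<close>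

definition S_odd :: "nat \<Rightarrow> int \<Rightarrow> int \<Rightarrow> real" where
  "S_odd g r p =
     1 / real_of_int p ^ (g + 1) *
       (\<Sum>n\<in>odds_upto (p - 2).
          (deriv ^^ g) cot (pi * real_of_int n / (2 * real_of_int p))
          / sin (pi * real_of_int n * (real_of_int r / real_of_int p)))"

definition divisor_power_sum :: "int \<Rightarrow> nat \<Rightarrow> real" where
  "divisor_power_sum k n = (\<Sum>d | 0 < d \<and> d dvd n. real d powi k)"

text \<open>
  \<open>E_odd k \<tau>\<close> is \<open>E\<^sub>k\<^sup>o\<^sup>d\<^sup>d(\<tau>)\<close> for \<open>k = -g \<le> 0\<close> and \<open>\<tau>\<close> in the upper half plane, where the series
  converges absolutely; its coefficients are \<open>\<sigma>\<^bsub>k-1\<^esub>(n) = \<sigma>\<^bsub>-g-1\<^esub>(n)\<close>.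
\<close>

definition E_odd :: "int \<Rightarrow> complex \<Rightarrow> complex" where
  "E_odd k \<tau> =
     (\<Sum>\<^sub>\<infinity>n\<in>{n::nat. 1 \<le> n \<and> odd n}.
        complex_of_real (divisor_power_sum (k - 1) n) * exp (complex_of_real pi * \<i> * of_nat n * \<tau>))"

definition sector :: "real \<Rightarrow> complex set" where
  "sector \<epsilon> = {\<tau>. \<tau> \<noteq> 0 \<and> \<epsilon> \<le> Arg \<tau> \<and> Arg \<tau> \<le> pi - \<epsilon>}"

text \<open>
  The value of \<open>p\<^sup>2 (32 / (\<pi>\<^sup>3 \<i>)) E_odd (-2) (\<tau> + x) - (8 / (\<pi> \<i>)) E_odd 0 (\<tau> + x) - 1 / (3 p\<^sup>2 \<tau>)\<close>
  as \<open>\<tau> \<rightarrow> 0\<close> is not \<open>\<sigma>\<^sub>2(x)\<close> itself: its real part is \<open>\<sigma>\<^sub>2(x)\<close>, but it has the imaginary part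
  \<open>2 ln 2 / \<pi>\<close>, which comes from \<open>E_odd 0\<close>. With \<open>q = exp (\<pi> \<i> \<tau>)\<close>, \<open>E_odd 0 \<tau>\<close> is one half of the
  logarithm of the product of \<open>(1 + q\<^sup>m) / (1 - q\<^sup>m)\<close> over odd \<open>m\<close>, a quotient of Weber functions;
  at every rational \<open>x\<close> with odd numerator and denominator this product has leading coefficient of
  absolute value \<open>\<surd>2\<close>, so that \<open>E_odd 0\<close> contributes \<open>ln 2 / 4\<close>.
  The theorem therefore states the limit as \<open>\<sigma>\<^sub>2(x) + \<i> (2 ln 2 / \<pi>)\<close>, the added constant being
  \<open>-(8 / (\<pi> \<i>)) (ln 2 / 4)\<close>, independent of \<open>x\<close>.
\<close>

end

theory Submission
  imports Defs
begin

text \<open>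
  Write \<open>a = \<pi> n / 2 p\<close> and \<open>b = \<pi> n r / p\<close>. The addition theorems collapse the numerator of the
  Marche--Masbaum formula to \<open>8 p sin b cos\<^sup>3 a + 8 cos b sin\<^sup>3 a\<close>. The first summand produces the
  cotangent sum, and the second one leaves \<open>\<Sum> cos b / sin\<^sup>2 b\<close>, whose value \<open>(p\<^sup>2 - 1) / 12\<close> cancels the
  rational terms. That value comes from \<open>4 cos b / sin\<^sup>2 b = 1 / sin\<^sup>2 (b/2) - 1 / cos\<^sup>2 (b/2)\<close> and
  \<open>\<Sum> 1 / (m + z)\<^sup>2 = \<pi>\<^sup>2 / sin\<^sup>2 (\<pi> z)\<close>: multiplication by \<open>r\<close> permutes the odd residues modulo \<open>2 p\<close>, so
  that the sums over residues reassemble to sums of inverse squares of all odd, or all even, integers.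
  The second equality is \<open>cot'' = 2 cot + 2 cot\<^sup>3\<close>.

  For the limit, summing the geometric series in the cofactor of each divisor gives
  \<open>E_odd (1 - j) T = (\<i>/4) \<Sum> d\<^bsup>-j\<^esup> / sin (\<pi> d T)\<close> over all odd integers \<open>d\<close> (lemma
  \<open>has_sum_E_odd_int\<close>). With \<open>T = \<tau> + r/p\<close>, \<open>s = p \<tau>\<close> and \<open>d = a + 2 p m = 2 p (\<alpha> + m)\<close>, a residue class
  contributes a multiple of
  \<open>\<Sum>\<^sub>m (\<alpha> + m)\<^bsup>-j\<^esup> \<cdot> 2 \<pi> / sin (2 \<pi> ((\<alpha> + m) s + \<beta>))\<close> with \<open>\<alpha> = a / 2 p\<close> and \<open>\<beta> = a r / 2 p\<close>.
  Its behaviour for \<open>s \<rightarrow> 0\<close> in a cone around the imaginary axis is found as follows.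

  \<^item> For \<open>j = 3\<close> the cosecant may be replaced by its value at \<open>s = 0\<close>, because the error
    \<open>O(\<bar>(\<alpha> + m) s\<bar>)\<close> is still summable against the cubic weight (\<open>cubic_cosecant_sum\<close>).
  \<^item> For \<open>j = 1\<close> that error is not summable. Instead the cosecant is expanded into partial fractions
    \<open>\<Sum>\<^sub>n 1 / (z + \<beta> + n) - 1 / (z + \<beta> + 1/2 + n)\<close> at \<open>z = (\<alpha> + m) s\<close>. The resulting double series converges
    absolutely, and in the other order of summation the inner sum over \<open>m\<close> is an exact expression in
    \<open>cot (\<pi> \<alpha>)\<close> and \<open>cot (\<pi> (\<alpha> + \<gamma> / s))\<close>, where \<open>\<gamma>\<close> is \<open>\<beta> + n\<close> or \<open>\<beta> + 1/2 + n\<close>. The latter tends to \<open>\<plusminus>\<i>\<close> according to the sign of \<open>\<gamma>\<close>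
    (\<open>linear_cosecant_sum\<close>). The terms with \<open>cot (\<pi> \<alpha>)\<close> yield \<open>S_odd 0\<close>. The terms with \<open>\<plusminus>\<i>\<close> add up, over
    all classes, to the alternating harmonic series, which is the origin of the constant with \<open>ln 2\<close>.

  The class \<open>a = p\<close> is the only one where the cosecant has a pole at \<open>s = 0\<close>. It produces the terms in \<open>1/\<tau>\<close>,
  through \<open>\<Sum> (m + 1/2)\<^bsup>-2\<^esup> = \<pi>\<^sup>2\<close> and \<open>\<Sum> (m + 1/2)\<^bsup>-4\<^esup> = \<pi>\<^sup>4 / 3\<close>. It is absent from the cotangent sums, since
  \<open>cot\<close> and \<open>cot''\<close> vanish at \<open>\<pi>/2\<close>.
\<close>

section \<open>Partial fractions over the integers\<close>

lemma has_sum_int_halves: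
  fixes f :: "int \<Rightarrow> 'a::topological_comm_monoid_add"
  assumes "((\<lambda>n::nat. f (int n)) has_sum S) UNIV" "((\<lambda>n::nat. f (- int n - 1)) has_sum T) UNIV"
  shows "(f has_sum (S + T)) UNIV"
proof -
  have "(f has_sum S) {0..}"
    using assms(1) by (subst has_sum_reindex_bij_witness[of _ int nat UNIV "\<lambda>n. f (int n)" _ S S]) auto
  moreover have "(f has_sum T) {..<0}"
    using assms(2)
    by (subst has_sum_reindex_bij_witness[of _ "\<lambda>n. - int n - 1" "\<lambda>n. nat (- n - 1)" UNIV "\<lambda>n. f (- int n - 1)" _ T T]) auto
  ultimately have "(f has_sum (S + T)) ({0..} \<union> {..<0})"
    by (intro has_sum_Un_disjoint) auto
  moreover have "{0..} \<union> {..<0::int} = UNIV" by auto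
  ultimately show ?thesis by simp
qed

lemma eventually_norm_add_of_nat_ge:
  fixes z :: "'a::real_normed_algebra_1"
  shows "eventually (\<lambda>n::nat. real n / 2 \<le> norm (z + of_nat n)) sequentially"
proof -
  obtain N :: nat where N: "2 * norm z \<le> real N" using real_arch_simple by blast
  show ?thesis
  proof (rule eventually_sequentiallyI[of N])
    fix n assume "N \<le> n"
    hence "2 * norm z \<le> real n" using N by linarith
    moreover have "norm (of_nat n :: 'a) - norm z \<le> norm (of_nat n + z)"
      by (rule norm_diff_ineq)
    ultimately show "real n / 2 \<le> norm (z + of_nat n)" by (simp add: add.commute)
  qed
qed

lemma summable_shifted_powr:
  fixes z :: "'a::real_normed_algebra_1"
  assumes q: "q > 1"
  shows "summable (\<lambda>n. norm (z + of_nat n) powr - q)"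
proof (rule summable_comparison_test_ev)
  show "summable (\<lambda>n. 2 powr q * real n powr - q)"
    using q by (intro summable_mult) (simp add: summable_real_powr_iff)
  show "eventually (\<lambda>n. norm (norm (z + of_nat n) powr - q) \<le> 2 powr q * real n powr - q) sequentially"
    using eventually_norm_add_of_nat_ge[of z] eventually_gt_at_top[of 0]
  proof eventually_elim
    case (elim n)
    have "norm (z + of_nat n) powr - q \<le> (real n / 2) powr - q"
      using elim q by (intro powr_mono2') auto
    also have "\<dots> = 2 powr q * real n powr - q"
      using elim by (simp add: powr_divide powr_minus field_simps)
    finally show ?case by simp
  qed
qed

lemma summable_on_int_powr:
  fixes z :: "'a::real_normed_algebra_1"
  assumes q: "q > 1"
  shows "(\<lambda>n::int. norm (z + of_int n) powr - q) summable_on UNIV"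
proof -
  have "(\<lambda>n. norm (z + of_nat n) powr - q) summable_on UNIV" for z :: 'a
    using summable_shifted_powr[OF q, of z] by (intro norm_summable_imp_summable_on) simp
  from this[of z] this[of "1 - z"]
  obtain S T where "((\<lambda>n. norm (z + of_nat n) powr - q) has_sum S) UNIV"
    and "((\<lambda>n. norm (1 - z + of_nat n) powr - q) has_sum T) UNIV"
    by (auto simp: summable_on_def)
  moreover have "norm (1 - z + of_nat n) = norm (z + of_int (- int n - 1))" for n
    by (subst norm_minus_cancel[symmetric]) (simp add: algebra_simps)
  ultimately have "((\<lambda>n::int. norm (z + of_int n) powr - q) has_sum (S + T)) UNIV"
    by (intro has_sum_int_halves) (simp_all del: of_int_diff of_int_minus)
  thus ?thesis by (rule has_sum_imp_summable)
qed

lemma norm_inverse_power_eq_powr: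
  fixes z :: "'a::real_normed_field"
  assumes "k > 0"
  shows "norm (1 / z ^ k) = norm z powr - real k"
  using assms
  by (cases "z = 0") (simp_all add: norm_divide norm_power powr_minus_divide powr_realpow)

lemma summable_on_int_inverse_power:
  fixes z :: "'a::{real_normed_field}"
  assumes k: "k \<ge> 2"
  shows "(\<lambda>n::int. norm (1 / (z + of_int n) ^ k)) summable_on UNIV"
proof -
  have "norm (1 / (z + of_int n) ^ k) = norm (z + of_int n) powr - real k" for n
    using k by (intro norm_inverse_power_eq_powr) simp
  thus ?thesis using summable_on_int_powr[of "real k" z] k by simp
qed

lemma shift_not_Int:
  fixes z :: complex
  assumes "z \<notin> \<int>" shows "z + of_int n \<noteq> 0" "1 - z \<notin> \<int>" "z \<noteq> 0" "z + of_nat m \<noteq> 0"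
proof -
  show "z + of_int n \<noteq> 0"
  proof
    assume "z + of_int n = 0"
    hence "z = of_int (- n)" by (simp add: eq_neg_iff_add_eq_0)
    thus False using assms Ints_of_int by blast
  qed
  show "1 - z \<notin> \<int>"
  proof
    assume "1 - z \<in> \<int>"
    hence "1 - (1 - z) \<in> \<int>" by (rule Ints_diff[OF Ints_1])
    moreover have "1 - (1 - z) = z" by simp
    ultimately show False using assms by metis
  qed
  show "z \<noteq> 0" using assms by auto
  show "z + of_nat m \<noteq> 0"
  proof
    assume "z + of_nat m = 0"
    hence "z = of_int (- int m)" by (simp add: eq_neg_iff_add_eq_0)
    thus False using assms Ints_of_int by blast
  qed
qed

lemma sin_pi_nonzero:
  assumes "z \<notin> \<int>" shows "sin (of_real pi * z :: complex) \<noteq> 0"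
proof
  assume "sin (of_real pi * z) = 0"
  then obtain n where "of_real pi * z = complex_of_real (of_int n * pi)"
    by (auto simp: sin_eq_0)
  hence "z = of_int n" by simp
  thus False using assms by simp
qed

text \<open>
  This is the logarithmic derivative of \<open>\<Gamma>(z) \<Gamma>(1 - z) = \<pi> / sin (\<pi> z)\<close>.
\<close>

lemma Digamma_reflection:
  fixes z :: complex
  assumes z: "z \<notin> \<int>"
  shows "Digamma (1 - z) - Digamma z = of_real pi * cot (of_real pi * z)"
proof -
  have z1: "z \<notin> \<int>\<^sub>\<le>\<^sub>0" "1 - z \<notin> \<int>\<^sub>\<le>\<^sub>0" using z shift_not_Int(2)[OF z] nonpos_Ints_subset_Ints by blast+
  have G0: "Gamma z * Gamma (1 - z) \<noteq> 0" using z1 by (simp add: Gamma_eq_zero_iff)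
  have s0: "sin (of_real pi * z) \<noteq> 0" using sin_pi_nonzero[OF z] .
  have "((\<lambda>z. Gamma z * Gamma (1 - z)) has_field_derivative
          (Gamma z * Gamma (1 - z)) * (Digamma z - Digamma (1 - z))) (at z)"
    using z1 by (auto intro!: derivative_eq_intros simp: algebra_simps)
  moreover have "((\<lambda>z. of_real pi / sin (of_real pi * z)) has_field_derivative
          - (of_real pi * (of_real pi * cos (of_real pi * z))) / (sin (of_real pi * z))^2) (at z)"
    using s0 by (auto intro!: derivative_eq_intros simp: power2_eq_square)
  moreover have "(\<lambda>z. Gamma z * Gamma (1 - z)) = (\<lambda>z. complex_of_real pi / sin (of_real pi * z))"
    by (simp add: Gamma_reflection_complex)
  ultimately have "(Gamma z * Gamma (1 - z)) * (Digamma z - Digamma (1 - z)) =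
     - (of_real pi * (of_real pi * cos (of_real pi * z))) / (sin (of_real pi * z))^2"
    by (metis DERIV_unique)
  hence "complex_of_real pi / sin (of_real pi * z) * (Digamma z - Digamma (1 - z)) =
     - (of_real pi * (of_real pi * cos (of_real pi * z))) / (sin (of_real pi * z))^2"
    by (simp add: Gamma_reflection_complex)
  moreover have "Digamma z - Digamma (1 - z) = complex_of_real pi / sin (of_real pi * z)
      * (Digamma z - Digamma (1 - z)) * (sin (of_real pi * z) / of_real pi)"
    using s0 by simp
  ultimately have "Digamma z - Digamma (1 - z) = - (of_real pi * cot (of_real pi * z))"
    using s0 by (simp add: cot_def power2_eq_square)
  thus ?thesis by (simp add: algebra_simps)
qed

lemma norm_summable_inverse_diff:
  fixes u v :: complex
  shows "summable (\<lambda>n. norm (1 / (u + of_nat n) - 1 / (v + of_nat n)))"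
proof (rule summable_comparison_test_ev)
  show "summable (\<lambda>n. norm (v - u) * (norm (u + of_nat n) powr - 2 + norm (v + of_nat n) powr - 2))"
    by (intro summable_mult summable_add summable_shifted_powr) auto
  show "eventually (\<lambda>n. norm (norm (1 / (u + of_nat n) - 1 / (v + of_nat n))) \<le>
      norm (v - u) * (norm (u + of_nat n) powr - 2 + norm (v + of_nat n) powr - 2)) sequentially"
    using eventually_norm_add_of_nat_ge[of u] eventually_norm_add_of_nat_ge[of v] eventually_gt_at_top[of 0]
  proof eventually_elim
    case (elim n)
    define a b where "a = norm (u + of_nat n)" and "b = norm (v + of_nat n)"
    have ab: "a > 0" "b > 0" using elim by (auto simp: a_def b_def intro!: less_le_trans[of 0 "real n / 2"])
    have "1 / (u + of_nat n) - 1 / (v + of_nat n) = (v - u) * (1 / ((u + of_nat n) * (v + of_nat n)))"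
      using ab by (auto simp: a_def b_def field_simps)
    hence eq: "norm (1 / (u + of_nat n) - 1 / (v + of_nat n)) = norm (v - u) * (1 / (a * b))"
      by (simp only: norm_mult norm_divide a_def b_def norm_one)
    have "1 / (a * b) \<le> 1 / a^2 + 1 / b^2"
    proof -
      have "0 \<le> (1/a - 1/b)^2" by simp
      hence "2 * (1 / (a * b)) \<le> 1 / a^2 + 1 / b^2" using ab by (simp add: power2_diff power_divide)
      moreover have "0 \<le> 1 / (a * b)" using ab by simp
      ultimately show ?thesis by linarith
    qed
    hence "1 / (a * b) \<le> a powr - 2 + b powr - 2" using ab by (simp add: powr_minus_divide)
    hence "norm (v - u) * (1 / (a * b)) \<le> norm (v - u) * (a powr - 2 + b powr - 2)"
      by (intro mult_left_mono) simp_all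
    hence "norm (1 / (u + of_nat n) - 1 / (v + of_nat n)) \<le> norm (v - u) * (a powr - 2 + b powr - 2)"
      by (simp only: eq)
    thus ?case by (simp only: a_def b_def real_norm_def abs_norm_cancel)
  qed
qed

text \<open>
  The indices \<open>n \<ge> 0\<close> and \<open>n < 0\<close> give differences of Digamma values at \<open>v, u\<close> and at \<open>1 - u, 1 - v\<close>, and
  the reflection formula combines them into cotangents. A single cotangent only has a conditionally
  convergent expansion over the integers; the difference makes it absolutely convergent, so that it
  can take part in rearrangements.
\<close>

lemma cot_difference_series:
  fixes u v :: complex
  assumes u: "u \<notin> \<int>" and v: "v \<notin> \<int>"
  shows "((\<lambda>n::int. 1 / (u + of_int n) - 1 / (v + of_int n)) has_sum
           (of_real pi * cot (of_real pi * u) - of_real pi * cot (of_real pi * v))) UNIV"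
proof -
  have half: "((\<lambda>n. 1 / (u + of_nat n) - 1 / (v + of_nat n)) has_sum (Digamma v - Digamma u)) UNIV"
    if "u \<noteq> 0" "v \<noteq> 0" for u v :: complex
  proof (rule norm_summable_imp_has_sum[OF norm_summable_inverse_diff])
    have "(\<lambda>n. (inverse (of_nat (Suc n)) - inverse (v + of_nat n))
         - (inverse (of_nat (Suc n)) - inverse (u + of_nat n))) sums
         ((Digamma v + euler_mascheroni) - (Digamma u + euler_mascheroni))"
      using summable_Digamma[OF that(1)] summable_Digamma[OF that(2)]
      by (intro sums_diff) (simp_all add: Digamma_def summable_sums)
    thus "(\<lambda>n. 1 / (u + of_nat n) - 1 / (v + of_nat n)) sums (Digamma v - Digamma u)"
      by (simp add: inverse_eq_divide)
  qed
  have *: "1 / (u + of_int (- int n - 1)) - 1 / (v + of_int (- int n - 1)) =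
      1 / (1 - v + of_nat n) - 1 / (1 - u + of_nat n)" for n
  proof -
    have "u + of_int (- int n - 1) = - (1 - u + of_nat n)" "v + of_int (- int n - 1) = - (1 - v + of_nat n)"
      by simp_all
    thus ?thesis by (simp only: divide_minus_right) simp
  qed
  have "((\<lambda>n::int. 1 / (u + of_int n) - 1 / (v + of_int n)) has_sum
     ((Digamma v - Digamma u) + (Digamma (1 - u) - Digamma (1 - v)))) UNIV"
    using half[of u v] half[of "1 - v" "1 - u"] shift_not_Int(3)[OF u] shift_not_Int(3)[OF v]
      shift_not_Int(3)[OF shift_not_Int(2)[OF u]] shift_not_Int(3)[OF shift_not_Int(2)[OF v]]
    by (intro has_sum_int_halves) (simp_all only: * of_int_of_nat_eq not_False_eq_True)
  thus ?thesis using Digamma_reflection[OF u] Digamma_reflection[OF v] by (simp add: algebra_simps)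
qed

lemma inverse_power_series_Polygamma:
  fixes z :: complex
  assumes z: "z \<notin> \<int>" and n: "n > 0"
  shows "((\<lambda>m::int. 1 / (z + of_int m) ^ Suc n) has_sum
     ((-1) ^ Suc n / fact n * (Polygamma n z + (-1) ^ Suc n * Polygamma n (1 - z)))) UNIV"
proof -
  have half: "((\<lambda>m. 1 / (w + of_nat m) ^ Suc n) has_sum ((-1) ^ Suc n * Polygamma n w / fact n)) UNIV"
    if w: "w \<notin> \<int>" for w :: complex
  proof (rule norm_summable_imp_has_sum)
    have "norm (1 / (w + of_nat m) ^ Suc n) = norm (w + of_nat m) powr - real (Suc n)" for m
      by (rule norm_inverse_power_eq_powr) simp
    thus "summable (\<lambda>m. norm (1 / (w + of_nat m) ^ Suc n))"
      using summable_shifted_powr[of "real (Suc n)" w] n by simp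
    show "(\<lambda>m. 1 / (w + of_nat m) ^ Suc n) sums ((-1) ^ Suc n * Polygamma n w / fact n)"
      using Polygamma_LIMSEQ[of w n] shift_not_Int(3)[OF w] n by (simp add: inverse_eq_divide)
  qed
  have *: "1 / (z + of_int (- int m - 1)) ^ Suc n = (-1) ^ Suc n * (1 / (1 - z + of_nat m) ^ Suc n)" for m
  proof -
    have "z + of_int (- int m - 1) = - (1 - z + of_nat m)" by simp
    hence "(z + of_int (- int m - 1)) ^ Suc n = (-1) ^ Suc n * (1 - z + of_nat m) ^ Suc n"
      by (simp only: power_minus[of "1 - z + of_nat m"])
    thus ?thesis by (cases "even n") (simp_all del: power_Suc of_int_diff of_int_minus)
  qed
  have "((\<lambda>m::int. 1 / (z + of_int m) ^ Suc n) has_sum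
     ((-1) ^ Suc n * Polygamma n z / fact n + (-1) ^ Suc n * ((-1) ^ Suc n * Polygamma n (1 - z) / fact n))) UNIV"
    by (intro has_sum_int_halves; (simp only: * of_int_of_nat_eq)?)
       (intro has_sum_cmult_right half shift_not_Int(2) z)+
  moreover have "(-1) ^ Suc n * Polygamma n z / fact n + (-1) ^ Suc n * ((-1) ^ Suc n * Polygamma n (1 - z) / fact n)
      = (-1) ^ Suc n / fact n * (Polygamma n z + (-1) ^ Suc n * Polygamma n (1 - z))"
    by (simp add: algebra_simps add_divide_distrib)
  ultimately show ?thesis by (simp only:)
qed

text \<open>
  One differentiation raises the order of the reflected Polygamma combination by one, so the closed
  forms of the sums of inverse powers follow one after the other from the Digamma reflection.
\<close>

lemma reflected_Polygamma_step:
  fixes z :: complex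
  assumes eq: "\<And>w. w \<notin> \<int> \<Longrightarrow> Polygamma n w + (-1) ^ Suc n * Polygamma n (1 - w) = F w"
    and F: "(F has_field_derivative F') (at z)" and z: "z \<notin> \<int>"
  shows "Polygamma (Suc n) z + (-1) ^ Suc (Suc n) * Polygamma (Suc n) (1 - z) = F'"
proof -
  have z1: "z \<notin> \<int>\<^sub>\<le>\<^sub>0" "1 - z \<notin> \<int>\<^sub>\<le>\<^sub>0" using z shift_not_Int(2)[OF z] nonpos_Ints_subset_Ints by blast+
  have "((\<lambda>w. Polygamma n w + (-1) ^ Suc n * Polygamma n (1 - w)) has_field_derivative
      Polygamma (Suc n) z + (-1) ^ Suc (Suc n) * Polygamma (Suc n) (1 - z)) (at z)"
    using z1 by (auto intro!: derivative_eq_intros)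
  hence "(F has_field_derivative
      Polygamma (Suc n) z + (-1) ^ Suc (Suc n) * Polygamma (Suc n) (1 - z)) (at z)"
    by (rule has_field_derivative_transform_within_open[of _ _ _ "- \<int>"])
       (use z eq in \<open>auto simp: open_Compl closed_Ints\<close>)
  thus ?thesis using F DERIV_unique by blast
qed

lemma inverse_power_series:
  fixes z :: complex
  assumes z: "z \<notin> \<int>"
  defines "s \<equiv> sin (of_real pi * z)" and "c \<equiv> cos (of_real pi * z)"
  shows inverse_square_series: "((\<lambda>m::int. 1 / (z + of_int m) ^ 2) has_sum (of_real pi ^ 2 / s ^ 2)) UNIV"
    and inverse_cube_series: "((\<lambda>m::int. 1 / (z + of_int m) ^ 3) has_sum (of_real pi ^ 3 * c / s ^ 3)) UNIV"
    and inverse_fourth_series: "((\<lambda>m::int. 1 / (z + of_int m) ^ 4) has_sum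
           (of_real pi ^ 4 * (s ^ 2 + 3 * c ^ 2) / (3 * s ^ 4))) UNIV"
proof -
  define S C where "S = (\<lambda>w::complex. sin (of_real pi * w))" and "C = (\<lambda>w::complex. cos (of_real pi * w))"
  have S0: "S w \<noteq> 0" if "w \<notin> \<int>" for w using sin_pi_nonzero[OF that] by (simp add: S_def)
  have dS: "(S has_field_derivative of_real pi * C w) (at w)"
    and dC: "(C has_field_derivative - of_real pi * S w) (at w)" for w
    unfolding S_def C_def by (auto intro!: derivative_eq_intros)
  note d = DERIV_chain2[OF dS] DERIV_chain2[OF dC]
  have sc: "C w ^ 2 = 1 - S w ^ 2" for w unfolding S_def C_def by (simp add: cos_squared_eq)
  have R0: "Polygamma 0 w + (-1) ^ Suc 0 * Polygamma 0 (1 - w) = - of_real pi * (C w / S w)"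
    if "w \<notin> \<int>" for w :: complex
    using Digamma_reflection[OF that] by (simp add: algebra_simps cot_def S_def C_def)
  have R1: "Polygamma (Suc 0) w + (-1) ^ Suc (Suc 0) * Polygamma (Suc 0) (1 - w) = of_real pi ^ 2 / S w ^ 2"
    if w: "w \<notin> \<int>" for w :: complex
  proof (rule reflected_Polygamma_step[OF R0 _ w])
    have "((\<lambda>w. - of_real pi * (C w / S w)) has_field_derivative
       - of_real pi * ((- of_real pi * S w * S w - C w * (of_real pi * C w)) / (S w * S w))) (at w)"
      by (rule DERIV_cmult[OF DERIV_divide[OF dC dS S0[OF w]]])
    also have "- of_real pi * ((- of_real pi * S w * S w - C w * (of_real pi * C w)) / (S w * S w))
        = of_real pi ^ 2 * (S w ^ 2 + C w ^ 2) / S w ^ 2"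
      by (simp add: power2_eq_square field_simps)
    finally show "((\<lambda>w. - of_real pi * (C w / S w)) has_field_derivative of_real pi ^ 2 / S w ^ 2) (at w)"
      by (simp add: sc)
  qed
  have R2: "Polygamma (Suc (Suc 0)) w + (-1) ^ Suc (Suc (Suc 0)) * Polygamma (Suc (Suc 0)) (1 - w)
       = - 2 * of_real pi ^ 3 * C w / S w ^ 3"
    if w: "w \<notin> \<int>" for w :: complex
  proof (rule reflected_Polygamma_step[OF R1 _ w])
    show "((\<lambda>w. of_real pi ^ 2 / S w ^ 2) has_field_derivative - 2 * of_real pi ^ 3 * C w / S w ^ 3) (at w)"
      using S0[OF w] by (auto intro!: derivative_eq_intros dS simp: power2_eq_square power3_eq_cube field_simps)
  qed
  have R3: "Polygamma (Suc (Suc (Suc 0))) w + (-1) ^ Suc (Suc (Suc (Suc 0))) * Polygamma (Suc (Suc (Suc 0))) (1 - w)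
       = 2 * of_real pi ^ 4 * (S w ^ 2 + 3 * C w ^ 2) / S w ^ 4"
    if w: "w \<notin> \<int>" for w :: complex
  proof (rule reflected_Polygamma_step[OF R2 _ w])
    show "((\<lambda>w. - 2 * of_real pi ^ 3 * C w / S w ^ 3) has_field_derivative
        2 * of_real pi ^ 4 * (S w ^ 2 + 3 * C w ^ 2) / S w ^ 4) (at w)"
      using S0[OF w] by (auto intro!: derivative_eq_intros dS dC simp: power_numeral_reduce field_simps)
  qed
  have sgn: "(-1::complex) ^ Suc (Suc (Suc (Suc 0))) = 1" by simp
  note R = inverse_power_series_Polygamma[OF z]
  show "((\<lambda>m::int. 1 / (z + of_int m) ^ 2) has_sum (of_real pi ^ 2 / s ^ 2)) UNIV"
    using R[of "Suc 0"] R1[OF z] by (simp add: s_def S_def numeral_2_eq_2)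
  show "((\<lambda>m::int. 1 / (z + of_int m) ^ 3) has_sum (of_real pi ^ 3 * c / s ^ 3)) UNIV"
    using R[of "Suc (Suc 0)"] R2[OF z]
    by (simp add: s_def S_def c_def C_def numeral_3_eq_3 del: power_Suc)
  show "((\<lambda>m::int. 1 / (z + of_int m) ^ 4) has_sum (of_real pi ^ 4 * (s ^ 2 + 3 * c ^ 2) / (3 * s ^ 4))) UNIV"
    using R[of "Suc (Suc (Suc 0))"] R3[OF z] sgn
    by (simp add: s_def S_def c_def C_def numeral_eq_Suc fact_numeral del: power_Suc)
qed

text \<open>
  The cosecant is a difference of cotangents half a period apart:
  \<open>cot x - cot (x + \<pi>/2) = cot x + tan x = 2 / sin (2 x)\<close>.
\<close>

lemma cosecant_series:
  fixes u :: complex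
  assumes u: "2 * u \<notin> \<int>"
  shows "((\<lambda>n::int. 1 / (u + of_int n) - 1 / (u + 1/2 + of_int n)) has_sum
           (2 * of_real pi / sin (2 * of_real pi * u))) UNIV"
proof -
  have u1: "u \<notin> \<int>" using u Ints_mult[of 2 u] by auto
  have u2: "u + 1/2 \<notin> \<int>"
  proof
    assume "u + 1/2 \<in> \<int>"
    hence "2 * (u + 1/2) - 1 \<in> \<int>" by (intro Ints_diff Ints_mult) auto
    thus False using u by (simp add: algebra_simps)
  qed
  have s: "sin (of_real pi * (u + 1/2)) = cos (of_real pi * u)" "cos (of_real pi * (u + 1/2)) = - sin (of_real pi * u)"
    by (simp_all add: distrib_left sin_add cos_add sin_of_real[symmetric] cos_of_real[symmetric]
       del: sin_of_real cos_of_real)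
  have "of_real pi * cot (of_real pi * u) - of_real pi * cot (of_real pi * (u + 1/2))
      = 2 * of_real pi / sin (2 * (of_real pi * u))"
  proof -
    define S C where "S = sin (of_real pi * u)" and "C = cos (of_real pi * u)"
    have "S \<noteq> 0" "C \<noteq> 0" "S^2 + C^2 = 1"
      using sin_pi_nonzero[OF u1] sin_pi_nonzero[OF u2] s by (auto simp: S_def C_def)
    have "of_real pi * cot (of_real pi * u) - of_real pi * cot (of_real pi * (u + 1/2))
       = of_real pi * ((S^2 + C^2) / (S * C))"
      using \<open>S \<noteq> 0\<close> \<open>C \<noteq> 0\<close> unfolding cot_def s S_def[symmetric] C_def[symmetric]
      by (simp add: field_simps power2_eq_square)
    also have "\<dots> = 2 * of_real pi / (2 * S * C)" using \<open>S^2 + C^2 = 1\<close> by simp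
    finally show ?thesis by (simp add: sin_double S_def C_def)
  qed
  thus ?thesis using cot_difference_series[OF u1 u2] by (simp add: mult.assoc)
qed

text \<open>
  The identity \<open>cot z \<plusminus> \<i> = exp (\<plusminus>\<i> z) / sin z\<close> shows that \<open>cot z\<close> approaches \<open>\<mp>\<i>\<close> exponentially fast away
  from the real axis. The weaker decay \<open>1 / \<bar>Im z\<bar>\<close> suffices for an error of order \<open>O(\<bar>s\<bar>)\<close> later on.
\<close>

lemma norm_cot_plus_minus_ii_le:
  fixes z :: complex
  assumes "Im z \<noteq> 0"
  shows "norm (cot z + of_real (sgn (Im z)) * \<i>) \<le> 2 / \<bar>Im z\<bar>"
proof -
  define y where "y = Im z"
  have e: "norm (exp (\<i> * z)) = exp (- y)" "norm (exp (- (\<i> * z))) = exp y"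
    by (simp_all add: norm_exp_eq_Re y_def)
  have sin: "2 * norm (sin z) = norm (exp (\<i> * z) - exp (- (\<i> * z)))"
    by (simp add: sin_exp_eq norm_divide norm_mult)
  have ge: "\<bar>exp (- y) - exp y\<bar> \<le> 2 * norm (sin z)"
    unfolding sin using norm_triangle_ineq3[of "exp (\<i> * z)" "exp (- (\<i> * z))"] by (simp add: y_def)
  have exps: "exp y \<ge> 1 + y" "exp (- y) \<ge> 1 - y" using exp_ge_add_one_self[of y] exp_ge_add_one_self[of "- y"] by auto
  show ?thesis
  proof (cases "y > 0")
    case True
    have "exp (- y) \<le> 1" using True by simp
    hence "y \<le> \<bar>exp (- y) - exp y\<bar>" using exps by linarith
    hence sy: "y \<le> 2 * norm (sin z)" using ge by linarith
    have "sin z \<noteq> 0" using sy True by auto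
    hence "cot z + \<i> = exp (\<i> * z) / sin z"
      by (simp add: cot_def exp_Euler add_divide_distrib)
    hence "norm (cot z + \<i>) = exp (- y) / norm (sin z)" by (simp only: norm_divide e)
    also have "\<dots> \<le> 1 / (y / 2)" using sy True by (intro frac_le) auto
    finally show ?thesis using True by (simp add: y_def)
  next
    case False
    hence y: "y < 0" using assms by (simp add: y_def)
    have "exp y \<le> 1" using y by simp
    hence "- y \<le> \<bar>exp (- y) - exp y\<bar>" using exps by linarith
    hence sy: "- y \<le> 2 * norm (sin z)" using ge by linarith
    have "exp (- (\<i> * z)) = cos z - \<i> * sin z" using exp_Euler[of "-z"] by simp
    moreover have "sin z \<noteq> 0" using sy y by auto
    ultimately have "cot z - \<i> = exp (- (\<i> * z)) / sin z"
      by (simp add: cot_def diff_divide_distrib)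
    hence "norm (cot z - \<i>) = exp y / norm (sin z)" by (simp only: norm_divide e)
    also have "\<dots> \<le> 1 / (- y / 2)" using sy y by (intro frac_le) auto
    finally show ?thesis using y by (simp add: y_def)
  qed
qed

section \<open>Cosecant sums with cubic weight\<close>

lemma has_sum_diff:
  fixes f g :: "'a \<Rightarrow> 'b::topological_ab_group_add"
  assumes "(f has_sum a) A" "(g has_sum b) A"
  shows "((\<lambda>x. f x - g x) has_sum (a - b)) A"
  using has_sum_add[OF assms(1), of "\<lambda>x. - g x" "- b"] assms(2) by (simp add: has_sum_uminus)

text \<open>
  The approach region of a nontangential limit. The constant \<open>c\<close> stands for the sine of the opening angle:
  the estimates use the inequality \<open>c \<bar>s\<bar> \<le> Im s\<close> and not the argument of \<open>s\<close>.
\<close>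

definition upper_cone :: "real \<Rightarrow> complex set" where
  "upper_cone c = {s. s \<noteq> 0 \<and> c * norm s \<le> Im s}"

text \<open>
  Both bounds are distances: the point \<open>-\<gamma>\<close> has distance at least \<open>c \<bar>\<gamma>\<bar>\<close> from the line \<open>\<real> s\<close>, and \<open>t s\<close> has
  distance at least \<open>c \<bar>t s\<bar>\<close> from the real axis.
\<close>

lemma upper_cone_lower_bounds:
  assumes s: "s \<in> upper_cone c"
  shows "c * \<bar>\<gamma>\<bar> \<le> norm (of_real t * s + of_real \<gamma>)" (is ?A)
    and "c * (\<bar>t\<bar> * norm s) \<le> norm (of_real t * s + of_real \<gamma>)" (is ?B)
proof -
  have s0: "norm s > 0" and ims: "c * norm s \<le> Im s" using s by (auto simp: upper_cone_def)
  have "c * \<bar>\<gamma>\<bar> * norm s \<le> \<bar>\<gamma>\<bar> * Im s"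
    using mult_left_mono[OF ims, of "\<bar>\<gamma>\<bar>"] by (simp add: mult_ac)
  also have "\<dots> \<le> \<bar>\<gamma> * Im s\<bar>" by (simp add: abs_mult mult_left_mono)
  also have "\<gamma> * Im s = - Im ((of_real t * s + of_real \<gamma>) * cnj s)"
    by (simp add: algebra_simps)
  also have "\<bar>\<dots>\<bar> \<le> norm ((of_real t * s + of_real \<gamma>) * cnj s)"
    unfolding abs_minus_cancel by (rule abs_Im_le_cmod)
  also have "\<dots> = norm (of_real t * s + of_real \<gamma>) * norm s" by (simp add: norm_mult)
  finally show ?A using s0 by simp
  have "c * (\<bar>t\<bar> * norm s) \<le> \<bar>t\<bar> * Im s"
    using mult_left_mono[OF ims, of "\<bar>t\<bar>"] by (simp add: mult_ac)
  also have "\<dots> \<le> \<bar>t * Im s\<bar>" by (simp add: abs_mult mult_left_mono)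
  also have "t * Im s = Im (of_real t * s + of_real \<gamma>)" by simp
  also have "\<bar>\<dots>\<bar> \<le> norm (of_real t * s + of_real \<gamma>)" by (rule abs_Im_le_cmod)
  finally show ?B .
qed

lemma upper_cone_nonzero:
  assumes s: "s \<in> upper_cone c" and c: "c > 0" and "\<gamma> \<noteq> 0 \<or> t \<noteq> 0"
  shows "of_real t * s + of_real \<gamma> \<noteq> 0"
proof
  assume eq: "of_real t * s + of_real \<gamma> = 0"
  have "norm s > 0" using s by (simp add: upper_cone_def)
  moreover have "c * \<bar>\<gamma>\<bar> \<le> 0" "c * (\<bar>t\<bar> * norm s) \<le> 0"
    using upper_cone_lower_bounds[OF s, where \<gamma> = \<gamma> and t = t] unfolding eq by simp_all
  ultimately show False using assms(3) c by (auto simp: mult_le_0_iff)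
qed

text \<open>
  Omitting the summand with \<open>\<gamma> = 0\<close> removes the pole at \<open>z = 0\<close> from a partial fraction expansion.
\<close>

definition pole_term :: "complex \<Rightarrow> real \<Rightarrow> complex" where
  "pole_term z \<gamma> = (if \<gamma> = 0 then 0 else 1 / (z + of_real \<gamma>))"

text \<open>
  For \<open>\<beta>\<close> not an integer, this is the residue at \<open>z = 0\<close> of \<open>- 2 \<pi> / sin (2 \<pi> (z + \<beta>))\<close>.
\<close>

definition pole_defect :: "real \<Rightarrow> complex" where
  "pole_defect \<beta> = (if \<beta> + 1/2 \<in> \<int> then 1 else 0)"

lemma add_of_int_nonzero: "(\<beta>::real) \<notin> \<int> \<Longrightarrow> \<beta> + of_int n \<noteq> 0"
proof
  assume \<beta>: "\<beta> \<notin> \<int>" and "\<beta> + of_int n = 0"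
  hence "\<beta> = of_int (- n)" by simp
  thus False using \<beta> Ints_of_int by blast
qed

lemma regularised_cosecant_series:
  assumes \<beta>: "\<beta> \<notin> \<int>" and z: "Im z \<noteq> 0"
  shows "((\<lambda>n::int. pole_term z (\<beta> + of_int n) - pole_term z (\<beta> + 1/2 + of_int n)) has_sum
     (2 * of_real pi / sin (2 * of_real pi * (z + of_real \<beta>)) + pole_defect \<beta> / z)) UNIV"
proof -
  have "Im (2 * (z + of_real \<beta>)) \<noteq> 0" using z by simp
  hence "2 * (z + of_real \<beta>) \<notin> \<int>" by (metis Ints_cases complex_Im_of_int)
  from cosecant_series[OF this]
  have csc: "((\<lambda>n::int. 1 / (z + of_real (\<beta> + of_int n)) - 1 / (z + of_real (\<beta> + 1/2 + of_int n))) has_sum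
     (2 * of_real pi / sin (2 * of_real pi * (z + of_real \<beta>)))) UNIV"
    by (simp add: add_ac)
  have "((\<lambda>n::int. if \<beta> + 1/2 + of_int n = 0 then 1 / z else 0) has_sum (pole_defect \<beta> / z)) UNIV"
  proof (cases "\<beta> + 1/2 \<in> \<int>")
    case True
    then obtain k where k: "\<beta> + 1/2 = of_int k" by (auto elim!: Ints_cases)
    have iff: "(\<beta> + 1/2 + of_int n = 0) = (n = - k)" for n :: int
      unfolding k by (metis of_int_add of_int_eq_0_iff add_eq_0_iff)
    show ?thesis unfolding iff
      by (rule has_sum_finite_neutralI[of "{- k}"]) (use True in \<open>auto simp: pole_defect_def\<close>)
  next
    case False
    thus ?thesis using add_of_int_nonzero[OF False] by (simp add: pole_defect_def)
  qed
  from has_sum_add[OF csc this] show ?thesis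
    by (rule has_sum_cong[THEN iffD1, rotated])
       (use add_of_int_nonzero[OF \<beta>] in \<open>auto simp: pole_term_def simp del: of_real_add\<close>)
qed

definition square_majorant :: "real \<Rightarrow> int \<Rightarrow> real" where
  "square_majorant \<beta> n = 1 / (\<beta> + of_int n)^2 + 1 / (\<beta> + 1/2 + of_int n)^2"

lemma summable_square_majorant: "square_majorant \<beta> summable_on UNIV"
  unfolding square_majorant_def
  using summable_on_int_inverse_power[of 2 \<beta>] summable_on_int_inverse_power[of 2 "\<beta> + 1/2"]
  by (intro summable_on_add) (simp_all add: norm_divide norm_power)

lemma inverse_mult_le_sum_squares:
  fixes a b :: real
  shows "1 / (\<bar>a\<bar> * \<bar>b\<bar>) \<le> 1 / a^2 + 1 / b^2"
proof -
  have "0 \<le> (1/\<bar>a\<bar> - 1/\<bar>b\<bar>)^2" by simp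
  hence "2 * (1 / (\<bar>a\<bar> * \<bar>b\<bar>)) \<le> 1 / a^2 + 1 / b^2" by (simp add: power2_diff power_divide)
  moreover have "0 \<le> 1 / (\<bar>a\<bar> * \<bar>b\<bar>)" by simp
  ultimately show ?thesis by linarith
qed

text \<open>
  The convention \<open>1 / 0 = 0\<close> is harmless here: in the exceptional case \<open>\<gamma> = -1/2\<close> the left-hand sides are 2
  and the right-hand side is 4. Both inequalities therefore also apply to the expansions with
  the singular summand left out.
\<close>

lemma half_step_differences_le:
  fixes \<gamma> :: real
  assumes "\<gamma> \<noteq> 0"
  shows "\<bar>1 / \<gamma> - 1 / (\<gamma> + 1/2)\<bar> \<le> 1 / \<gamma>^2 + 1 / (\<gamma> + 1/2)^2"
    and "\<bar>1 / \<bar>\<gamma>\<bar> - 1 / \<bar>\<gamma> + 1/2\<bar>\<bar> \<le> 1 / \<gamma>^2 + 1 / (\<gamma> + 1/2)^2"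
proof -
  have *: "\<bar>1 / a - 1 / b\<bar> \<le> 1 / \<gamma>^2 + 1 / (\<gamma> + 1/2)^2"
    if ab: "\<bar>a\<bar> = \<bar>\<gamma>\<bar>" "\<bar>b\<bar> = \<bar>\<gamma> + 1/2\<bar>" "\<bar>b - a\<bar> \<le> 1/2" for a b :: real
  proof (cases "b = 0")
    case True
    hence "\<gamma> = - (1/2)" using ab by simp
    moreover from this have a: "\<bar>a\<bar> = 1/2" using ab by simp
    have "\<bar>1 / a - 1 / b\<bar> = 2" using True by (simp add: a)
    ultimately show ?thesis by (simp add: power2_eq_square)
  next
    case False
    have "a \<noteq> 0" using ab assms by auto
    hence "\<bar>1 / a - 1 / b\<bar> = \<bar>b - a\<bar> * (1 / (\<bar>a\<bar> * \<bar>b\<bar>))"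
      using False by (simp add: diff_frac_eq abs_mult)
    also have "\<dots> \<le> 1 * (1 / (\<bar>a\<bar> * \<bar>b\<bar>))" using ab by (intro mult_right_mono) auto
    also have "\<dots> \<le> 1 / a^2 + 1 / b^2" using inverse_mult_le_sum_squares by simp
    also have "a^2 = \<gamma>^2" using power2_abs[of a] power2_abs[of \<gamma>] unfolding ab by simp
    also have "b^2 = (\<gamma> + 1/2)^2" using power2_abs[of b] power2_abs[of "\<gamma> + 1/2"] unfolding ab by simp
    finally show ?thesis .
  qed
  show "\<bar>1 / \<gamma> - 1 / (\<gamma> + 1/2)\<bar> \<le> 1 / \<gamma>^2 + 1 / (\<gamma> + 1/2)^2"
    by (rule *) auto
  show "\<bar>1 / \<bar>\<gamma>\<bar> - 1 / \<bar>\<gamma> + 1/2\<bar>\<bar> \<le> 1 / \<gamma>^2 + 1 / (\<gamma> + 1/2)^2"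
    by (rule *) (simp, simp, linarith)
qed

text \<open>
  The value at \<open>z = 0\<close> of \<open>2 \<pi> / sin (2 \<pi> (z + \<beta>))\<close> after removal of a possible pole.
\<close>

definition reg_cosecant_at_0 :: "real \<Rightarrow> complex" where
  "reg_cosecant_at_0 \<beta> = (\<Sum>\<^sub>\<infinity>n::int. pole_term 0 (\<beta> + of_int n) - pole_term 0 (\<beta> + 1/2 + of_int n))"

text \<open>
  This sum collects the limits \<open>\<plusminus>\<i>\<close> of the cotangents in the linearly weighted cosecant sum. For a single
  \<open>\<beta>\<close> it is a combination of Digamma values; only its sum over all odd residue classes is simple.
\<close>

definition abs_half_step_sum :: "real \<Rightarrow> real" where
  "abs_half_step_sum \<beta> = (\<Sum>\<^sub>\<infinity>n::int. 1 / \<bar>\<beta> + of_int n\<bar> - 1 / \<bar>\<beta> + 1/2 + of_int n\<bar>)"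

lemma has_sum_reg_cosecant_at_0:
  assumes "\<beta> \<notin> \<int>"
  shows "((\<lambda>n::int. pole_term 0 (\<beta> + of_int n) - pole_term 0 (\<beta> + 1/2 + of_int n)) has_sum
            reg_cosecant_at_0 \<beta>) UNIV"
  unfolding reg_cosecant_at_0_def
proof (rule has_sum_infsum, rule abs_summable_summable, rule Infinite_Sum.abs_summable_on_comparison_test'[OF summable_square_majorant])
  fix n :: int
  have p: "pole_term 0 \<gamma> = of_real (1 / \<gamma>)" for \<gamma> by (simp add: pole_term_def)
  show "norm (pole_term 0 (\<beta> + of_int n) - pole_term 0 (\<beta> + 1/2 + of_int n)) \<le> square_majorant \<beta> n"
    unfolding p of_real_diff[symmetric] norm_of_real square_majorant_def
    using half_step_differences_le(1)[OF add_of_int_nonzero[OF assms, of n]] by (simp add: add_ac)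
qed

lemma has_sum_abs_half_step_sum:
  assumes "\<beta> \<notin> \<int>"
  shows "((\<lambda>n::int. 1 / \<bar>\<beta> + of_int n\<bar> - 1 / \<bar>\<beta> + 1/2 + of_int n\<bar>) has_sum abs_half_step_sum \<beta>) UNIV"
  unfolding abs_half_step_sum_def
proof (rule has_sum_infsum, rule abs_summable_summable, rule Infinite_Sum.abs_summable_on_comparison_test'[OF summable_square_majorant])
  fix n :: int
  show "norm (1 / \<bar>\<beta> + of_int n\<bar> - 1 / \<bar>\<beta> + 1/2 + of_int n\<bar>) \<le> square_majorant \<beta> n"
    unfolding square_majorant_def real_norm_def
    using half_step_differences_le(2)[OF add_of_int_nonzero[OF assms, of n]] by (simp add: add_ac)
qed

text \<open>
  Quadratic decay in \<open>\<gamma>\<close> is what makes the Lipschitz constants of the partial fractions summable.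
\<close>

lemma pole_term_Lipschitz:
  assumes s: "s \<in> upper_cone c" and c: "c > 0"
  shows "norm (pole_term (of_real t * s) \<gamma> - pole_term 0 \<gamma>) \<le> \<bar>t\<bar> * norm s / c * (1 / \<gamma>^2)"
proof (cases "\<gamma> = 0")
  case False
  let ?z = "of_real t * s"
  have z: "?z + of_real \<gamma> \<noteq> 0" using upper_cone_nonzero[OF s c] False by blast
  have "pole_term ?z \<gamma> - pole_term 0 \<gamma> = - ?z / ((?z + of_real \<gamma>) * of_real \<gamma>)"
    using False z by (simp add: pole_term_def field_simps)
  hence "norm (pole_term ?z \<gamma> - pole_term 0 \<gamma>) = \<bar>t\<bar> * norm s / (norm (?z + of_real \<gamma>) * \<bar>\<gamma>\<bar>)"
    by (simp add: norm_divide norm_mult)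
  also have "\<dots> \<le> \<bar>t\<bar> * norm s / (c * \<bar>\<gamma>\<bar> * \<bar>\<gamma>\<bar>)"
    using False c z by (intro divide_left_mono mult_right_mono upper_cone_lower_bounds(1)[OF s]) auto
  finally show ?thesis by (simp add: power2_eq_square mult.assoc)
qed (simp add: pole_term_def)

lemma reg_cosecant_Lipschitz:
  assumes s: "s \<in> upper_cone c" and c: "c > 0" and \<beta>: "\<beta> \<notin> \<int>" and t: "t \<noteq> 0"
  shows "norm (2 * of_real pi / sin (2 * of_real pi * (of_real t * s + of_real \<beta>))
      + pole_defect \<beta> / (of_real t * s) - reg_cosecant_at_0 \<beta>)
    \<le> \<bar>t\<bar> * norm s / c * infsum (square_majorant \<beta>) UNIV"
proof (rule norm_infsum_le)
  have "Im s > 0" using s c by (auto simp: upper_cone_def intro: less_le_trans[of 0 "c * norm s"])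
  hence im: "Im (of_real t * s) \<noteq> 0" using t by simp
  show "((\<lambda>n::int. (pole_term (of_real t * s) (\<beta> + of_int n) - pole_term (of_real t * s) (\<beta> + 1/2 + of_int n))
       - (pole_term 0 (\<beta> + of_int n) - pole_term 0 (\<beta> + 1/2 + of_int n))) has_sum
      (2 * of_real pi / sin (2 * of_real pi * (of_real t * s + of_real \<beta>))
      + pole_defect \<beta> / (of_real t * s) - reg_cosecant_at_0 \<beta>)) UNIV"
    by (intro has_sum_diff regularised_cosecant_series[OF \<beta> im] has_sum_reg_cosecant_at_0[OF \<beta>])
  show "((\<lambda>n. \<bar>t\<bar> * norm s / c * square_majorant \<beta> n) has_sum \<bar>t\<bar> * norm s / c * infsum (square_majorant \<beta>) UNIV) UNIV"
    by (intro has_sum_cmult_right has_sum_infsum summable_square_majorant)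
  fix n :: int
  let ?d = "\<lambda>\<gamma>. pole_term (of_real t * s) \<gamma> - pole_term 0 \<gamma>"
  have "norm (?d (\<beta> + of_int n) - ?d (\<beta> + 1/2 + of_int n)) \<le>
     norm (?d (\<beta> + of_int n)) + norm (?d (\<beta> + 1/2 + of_int n))" by (rule norm_triangle_ineq4)
  also have "\<dots> \<le> \<bar>t\<bar> * norm s / c * square_majorant \<beta> n"
    unfolding square_majorant_def distrib_left by (intro add_mono pole_term_Lipschitz[OF s c])
  finally show "norm ((pole_term (of_real t * s) (\<beta> + of_int n) - pole_term (of_real t * s) (\<beta> + 1/2 + of_int n))
       - (pole_term 0 (\<beta> + of_int n) - pole_term 0 (\<beta> + 1/2 + of_int n)))
       \<le> \<bar>t\<bar> * norm s / c * square_majorant \<beta> n"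
    by (simp add: algebra_simps)
qed

definition cosecant_term :: "nat \<Rightarrow> real \<Rightarrow> real \<Rightarrow> complex \<Rightarrow> int \<Rightarrow> complex" where
  "cosecant_term k \<alpha> \<beta> s m = 1 / of_real (\<alpha> + of_int m) ^ k *
     (2 * of_real pi / sin (2 * of_real pi * (of_real (\<alpha> + of_int m) * s + of_real \<beta>)))"

text \<open>
  With \<open>t = \<alpha> + m\<close>, replacing the regularised cosecant at \<open>t s\<close> by its value at 0 costs \<open>O(\<bar>t s\<bar>)\<close>, which the weight
  \<open>1 / t\<^sup>3\<close> turns into the summable \<open>O(\<bar>s\<bar> / t\<^sup>2)\<close>. The pole \<open>- 1 / (t s)\<close>, if present, is summed exactly.
\<close>

lemma cubic_cosecant_sum:
  assumes \<alpha>: "\<alpha> \<notin> \<int>" and \<beta>: "\<beta> \<notin> \<int>" and c: "c > 0"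
    and S3: "((\<lambda>m::int. 1 / complex_of_real (\<alpha> + of_int m) ^ 3) has_sum S3) UNIV"
    and S4: "((\<lambda>m::int. 1 / complex_of_real (\<alpha> + of_int m) ^ 4) has_sum S4) UNIV"
  shows "\<exists>C. \<forall>s\<in>upper_cone c. \<exists>Q. (cosecant_term 3 \<alpha> \<beta> s has_sum Q) UNIV \<and>
           norm (Q + pole_defect \<beta> * S4 / s - reg_cosecant_at_0 \<beta> * S3) \<le> C * norm s"
proof -
  define h where "h = reg_cosecant_at_0 \<beta>"
  define \<kappa> where "\<kappa> = pole_defect \<beta>"
  define M where "M = infsum (square_majorant \<beta>) UNIV / c"
  define N where "N = infsum (square_majorant \<alpha>) UNIV"
  define t where "t = (\<lambda>m::int. \<alpha> + of_int m)"
  have t0: "t m \<noteq> 0" for m using add_of_int_nonzero[OF \<alpha>] by (simp add: t_def)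
  have M0: "M \<ge> 0" unfolding M_def using c by (intro divide_nonneg_pos infsum_nonneg) (auto simp: square_majorant_def)
  show ?thesis
  proof (intro exI[of _ "M * N"] ballI)
    fix s assume s: "s \<in> upper_cone c"
    define F where "F = (\<lambda>m. 2 * of_real pi / sin (2 * of_real pi * (of_real (t m) * s + of_real \<beta>)))"
    define D where "D = (\<lambda>m. 1 / of_real (t m) ^ 3 * (F m + \<kappa> / (of_real (t m) * s) - h))"
    have s0: "s \<noteq> 0" using s by (simp add: upper_cone_def)
    \<comment> \<open>Dividing by \<open>t\<^sup>3\<close> leaves two powers of \<open>t\<close> for convergence.\<close>
    have bound: "norm (D m) \<le> M * norm s * square_majorant \<alpha> m" for m
    proof -
      have "norm (D m) = 1 / \<bar>t m\<bar> ^ 3 * norm (F m + \<kappa> / (of_real (t m) * s) - h)"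
        by (simp add: D_def norm_mult norm_divide norm_power)
      also have "\<dots> \<le> 1 / \<bar>t m\<bar> ^ 3 * (\<bar>t m\<bar> * norm s * M)"
        using reg_cosecant_Lipschitz[OF s c \<beta> t0[of m]] unfolding F_def \<kappa>_def h_def M_def
        by (intro mult_left_mono) auto
      also have "\<dots> = M * norm s * (1 / (t m)^2)"
      proof -
        have "1 / a ^ 3 * (a * x * y) = y * x * (1 / a^2)" if "a \<noteq> 0" for a x y :: real
          using that by (simp add: power2_eq_square power3_eq_cube)
        from this[of "\<bar>t m\<bar>" "norm s" M] show ?thesis using t0[of m] by simp
      qed
      also have "\<dots> \<le> M * norm s * square_majorant \<alpha> m"
        using M0 by (intro mult_left_mono) (auto simp: square_majorant_def t_def)
      finally show ?thesis .
    qed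
    have maj: "((\<lambda>m. M * norm s * square_majorant \<alpha> m) has_sum M * norm s * N) UNIV"
      unfolding N_def by (intro has_sum_cmult_right has_sum_infsum summable_square_majorant)
    have "D summable_on UNIV"
      by (rule abs_summable_summable, rule Infinite_Sum.abs_summable_on_comparison_test'[OF has_sum_imp_summable[OF maj]])
         (rule bound)
    then obtain d where d: "(D has_sum d) UNIV" by (auto simp: summable_on_def)
    have nd: "norm d \<le> M * norm s * N" by (rule norm_infsum_le[OF d maj bound])
    have "((\<lambda>m. D m + h * (1 / of_real (t m) ^ 3) - \<kappa> / s * (1 / of_real (t m) ^ 4)) has_sum
        (d + h * S3 - \<kappa> / s * S4)) UNIV"
      using S3 S4 d unfolding t_def by (intro has_sum_add has_sum_diff has_sum_cmult_right)
    also have "(\<lambda>m. D m + h * (1 / of_real (t m) ^ 3) - \<kappa> / s * (1 / of_real (t m) ^ 4)) = cosecant_term 3 \<alpha> \<beta> s"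
    proof
      fix m
      have "1 / X ^ 3 * (f + \<kappa> / (X * s) - h) + h * (1 / X ^ 3) - \<kappa> / s * (1 / X ^ 4) = 1 / X ^ 3 * f"
        if "X \<noteq> 0" for X f :: complex
        using that s0 by (simp add: field_simps power_numeral_reduce)
      from this[of "of_real (t m)" "F m"] t0[of m]
      have "1 / of_real (t m) ^ 3 * (F m + \<kappa> / (of_real (t m) * s) - h) + h * (1 / of_real (t m) ^ 3)
          - \<kappa> / s * (1 / of_real (t m) ^ 4) = 1 / of_real (t m) ^ 3 * F m"
        by (simp only: of_real_eq_0_iff not_False_eq_True)
      thus "D m + h * (1 / of_real (t m) ^ 3) - \<kappa> / s * (1 / of_real (t m) ^ 4) = cosecant_term 3 \<alpha> \<beta> s m"
        by (simp only: D_def F_def cosecant_term_def t_def)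
    qed
    finally have Q: "(cosecant_term 3 \<alpha> \<beta> s has_sum (d + h * S3 - \<kappa> / s * S4)) UNIV" .
    thus "\<exists>Q. (cosecant_term 3 \<alpha> \<beta> s has_sum Q) UNIV \<and>
           norm (Q + pole_defect \<beta> * S4 / s - reg_cosecant_at_0 \<beta> * S3) \<le> M * N * norm s"
      using nd by (intro exI[of _ "d + h * S3 - \<kappa> / s * S4"]) (auto simp: h_def \<kappa>_def mult_ac)
  qed
qed

section \<open>Cosecant sums with linear weight\<close>

definition sesqui_majorant :: "real \<Rightarrow> int \<Rightarrow> real" where
  "sesqui_majorant \<beta> n = \<bar>\<beta> + of_int n\<bar> powr - (3/2) + \<bar>\<beta> + 1/2 + of_int n\<bar> powr - (3/2)"

lemma summable_sesqui_majorant: "sesqui_majorant \<beta> summable_on UNIV"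
  unfolding sesqui_majorant_def
  using summable_on_int_powr[of "3/2" \<beta>] summable_on_int_powr[of "3/2" "\<beta> + 1/2"]
  by (intro summable_on_add) simp_all

lemma powr_three_halves: "x \<ge> 0 \<Longrightarrow> x powr - (3/2) = 1 / (x * sqrt x)" for x :: real
proof (cases "x = 0")
  case False
  assume "x \<ge> 0"
  have "x powr (3/2) = x powr (1 + 1/2)" by simp
  also have "\<dots> = x * sqrt x"
    using \<open>x \<ge> 0\<close> False unfolding powr_add by (simp add: powr_half_sqrt)
  finally show ?thesis by (simp add: powr_minus_divide)
qed simp

text \<open>
  The difference is \<open>(1/2) / ((z + \<gamma>) (z + \<gamma> + 1/2))\<close> with \<open>z = t s\<close>. One factor is bounded below by a multiple of
  \<open>\<bar>\<gamma>\<bar>\<close> and the other one by a multiple of the geometric mean of \<open>\<bar>\<gamma> + 1/2\<bar>\<close> and \<open>\<bar>t s\<bar>\<close>. This leaves the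
  exponents \<open>3/2\<close> in \<open>\<gamma>\<close> and \<open>1/2\<close> in \<open>t\<close>; together with the weight \<open>1 / t\<close> the double series is then
  summable in both variables. The constant depends on \<open>s\<close>, which is fixed when the order of summation is changed.
\<close>

lemma pole_term_difference_le:
  assumes s: "s \<in> upper_cone c" and c: "c > 0" and t: "t \<noteq> 0" and \<gamma>: "\<gamma> \<noteq> 0"
  shows "norm (pole_term (of_real t * s) \<gamma> - pole_term (of_real t * s) (\<gamma> + 1/2))
    \<le> (1 / (c^2 * sqrt (norm s)) + 1 / (c * sqrt (norm s))) / sqrt \<bar>t\<bar>
       * (\<bar>\<gamma>\<bar> powr - (3/2) + \<bar>\<gamma> + 1/2\<bar> powr - (3/2))"
proof -
  let ?z = "of_real t * s"
  define \<gamma>' where "\<gamma>' = \<gamma> + 1/2"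
  define g where "g = \<bar>\<gamma>\<bar> powr - (3/2) + \<bar>\<gamma>'\<bar> powr - (3/2)"
  define S T where "S = sqrt (norm s)" and "T = sqrt \<bar>t\<bar>"
  have ST: "S > 0" "T > 0" using s t by (auto simp: S_def T_def upper_cone_def)
  have low: "c * (sqrt \<bar>\<delta>\<bar> * (T * S)) \<le> norm (?z + of_real \<delta>)" for \<delta>
  proof (rule power2_le_imp_le)
    have "(c * (sqrt \<bar>\<delta>\<bar> * (T * S)))^2 = (c * \<bar>\<delta>\<bar>) * (c * (\<bar>t\<bar> * norm s))"
      by (simp add: power_mult_distrib S_def T_def power2_eq_square mult_ac)
    also have "\<dots> \<le> norm (?z + of_real \<delta>) * norm (?z + of_real \<delta>)"
      using c by (intro mult_mono upper_cone_lower_bounds[OF s]) auto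
    finally show "(c * (sqrt \<bar>\<delta>\<bar> * (T * S)))^2 \<le> norm (?z + of_real \<delta>)^2" by (simp add: power2_eq_square)
  qed auto
  have z: "?z + of_real \<gamma> \<noteq> 0" "\<gamma>' \<noteq> 0 \<Longrightarrow> ?z + of_real \<gamma>' \<noteq> 0"
    using upper_cone_nonzero[OF s c] \<gamma> by blast+
  have g0: "g \<ge> 0" by (simp add: g_def)
  have "norm (pole_term ?z \<gamma> - pole_term ?z \<gamma>') \<le> (1 / (c^2 * S) + 1 / (c * S)) / T * g"
  proof (cases "\<gamma>' = 0")
    case True
    hence \<gamma>h: "\<bar>\<gamma>\<bar> = 1/2" by (simp add: \<gamma>'_def)
    have "norm (pole_term ?z \<gamma> - pole_term ?z \<gamma>') = 1 / norm (?z + of_real \<gamma>)"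
      using True \<gamma> by (simp add: pole_term_def norm_divide)
    also have "\<dots> \<le> 1 / (c * (sqrt \<bar>\<gamma>\<bar> * (T * S)))"
      using low[of \<gamma>] ST c \<gamma> by (intro divide_left_mono) (auto intro!: mult_pos_pos z)
    also have "\<dots> = 1 / (c * S) / T * (1 / sqrt \<bar>\<gamma>\<bar>)" by (simp add: field_simps)
    also have "\<dots> \<le> 1 / (c * S) / T * (1 / (\<bar>\<gamma>\<bar> * sqrt \<bar>\<gamma>\<bar>))"
      using ST c \<gamma> by (intro mult_left_mono divide_left_mono) (auto simp: \<gamma>h)
    also have "\<dots> \<le> 1 / (c * S) / T * g"
      using ST c by (intro mult_left_mono) (auto simp: g_def powr_three_halves)
    also have "\<dots> \<le> (1 / (c^2 * S) + 1 / (c * S)) / T * g"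
      using ST c g0 by (intro mult_right_mono divide_right_mono) auto
    finally show ?thesis .
  next
    case False
    define a b where "a = 1 / sqrt \<bar>\<gamma>\<bar>" and "b = 1 / sqrt \<bar>\<gamma>'\<bar>"
    have ab: "a > 0" "b > 0" using \<gamma> False by (auto simp: a_def b_def)
    have "\<gamma>' = \<gamma> + 1/2" by (simp add: \<gamma>'_def)
    hence "pole_term ?z \<gamma> - pole_term ?z \<gamma>' = (1/2) / ((?z + of_real \<gamma>) * (?z + of_real \<gamma>'))"
      using z \<gamma> False by (simp add: pole_term_def diff_frac_eq)
    hence "norm (pole_term ?z \<gamma> - pole_term ?z \<gamma>') = (1/2) / (norm (?z + of_real \<gamma>) * norm (?z + of_real \<gamma>'))"
      by (simp add: norm_divide norm_mult)
    also have "\<dots> \<le> (1/2) / ((c * \<bar>\<gamma>\<bar>) * (c * (sqrt \<bar>\<gamma>'\<bar> * (T * S))))"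
      using ST c \<gamma> False z
      by (intro divide_left_mono mult_mono low upper_cone_lower_bounds(1)[OF s]) (auto intro!: mult_pos_pos)
    also have "\<dots> = (1 / (c^2 * S)) / T * ((1/2) * (a^2 * b))"
      using \<gamma> by (simp add: a_def b_def power2_eq_square field_simps)
    also have "\<dots> \<le> (1 / (c^2 * S)) / T * g"
    proof (intro mult_left_mono)
      \<comment> \<open>Separates \<open>\<gamma>\<close> from \<open>\<gamma> + 1/2\<close>, so that both exponents are \<open>3/2\<close>.\<close>
      have "a^2 * b \<le> a^3 + b^3"
      proof (cases "a \<le> b")
        case True
        hence "a^2 * b \<le> b^2 * b" using ab by (intro mult_right_mono power_mono) auto
        thus ?thesis using ab by (simp add: power2_eq_square power3_eq_cube add_increasing)
      next
        case False
        hence "a^2 * b \<le> a^2 * a" using ab by (intro mult_left_mono) auto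
        thus ?thesis using ab by (simp add: power2_eq_square power3_eq_cube add_increasing2)
      qed
      moreover have "a ^ 3 = \<bar>\<gamma>\<bar> powr - (3/2)" "b ^ 3 = \<bar>\<gamma>'\<bar> powr - (3/2)"
        by (simp_all add: a_def b_def powr_three_halves power3_eq_cube)
      ultimately have "a^2 * b \<le> g" by (simp add: g_def)
      moreover have "0 \<le> a^2 * b" using ab by simp
      ultimately show "(1/2) * (a^2 * b) \<le> g" by linarith
    qed (use ST c in auto)
    also have "\<dots> \<le> (1 / (c^2 * S) + 1 / (c * S)) / T * g"
      using ST c g0 by (intro mult_right_mono divide_right_mono) auto
    finally show ?thesis .
  qed
  thus ?thesis by (simp add: \<gamma>'_def g_def S_def T_def)
qed

lemma abs_summable_on_product:
  fixes a b :: "_ \<Rightarrow> real"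
  assumes "a summable_on A" "b summable_on B" "\<And>x. x \<in> A \<Longrightarrow> a x \<ge> 0" "\<And>y. y \<in> B \<Longrightarrow> b y \<ge> 0"
  shows "(\<lambda>(x, y). a x * b y) summable_on A \<times> B"
proof (rule summable_on_SigmaI)
  fix x assume "x \<in> A"
  show "((\<lambda>y. (case (x, y) of (x, y) \<Rightarrow> a x * b y)) has_sum a x * infsum b B) B"
    using assms(2) by (simp add: has_sum_cmult_right)
qed (use assms in \<open>auto intro: summable_on_cmult_left\<close>)

text \<open>
  The summands decompose as \<open>1 / (t (t s + \<gamma>)) = (1/\<gamma>) (1 / t - 1 / (t + \<gamma> / s))\<close> with \<open>t = \<alpha> + m\<close>.
\<close>

lemma shifted_pole_sum:
  assumes \<alpha>: "\<alpha> \<notin> \<int>" and s: "Im s > 0"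
  defines "K \<equiv> \<lambda>\<gamma>. if \<gamma> = 0 then 0 else 1 / complex_of_real \<gamma> *
     (of_real pi * cot (of_real (pi * \<alpha>)) - of_real pi * cot (of_real pi * (of_real \<alpha> + of_real \<gamma> / s)))"
  shows "((\<lambda>m::int. 1 / of_real (\<alpha> + of_int m) * pole_term (of_real (\<alpha> + of_int m) * s) \<gamma>) has_sum K \<gamma>) UNIV"
proof (cases "\<gamma> = 0")
  case False
  have s0: "s \<noteq> 0" using s by auto
  let ?v = "of_real \<alpha> + of_real \<gamma> / s"
  have "Im (of_real \<gamma> / s) = - \<gamma> * Im s / (norm s)^2" by (simp add: Im_divide cmod_power2)
  hence "Im ?v \<noteq> 0" using False s s0 by simp
  hence v: "?v \<notin> \<int>" by (metis Ints_cases complex_Im_of_int)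
  have a: "complex_of_real \<alpha> \<notin> \<int>"
    using \<alpha> by (metis Ints_cases Ints_of_int of_real_eq_iff of_real_of_int_eq)
  have "((\<lambda>m::int. 1 / of_real \<gamma> * (1 / (of_real \<alpha> + of_int m) - 1 / (?v + of_int m))) has_sum K \<gamma>) UNIV"
    using has_sum_cmult_right[OF cot_difference_series[OF a v], of "1 / of_real \<gamma>"] False by (simp add: K_def)
  moreover have "1 / of_real \<gamma> * (1 / (of_real \<alpha> + of_int m) - 1 / (?v + of_int m))
      = 1 / of_real (\<alpha> + of_int m) * pole_term (of_real (\<alpha> + of_int m) * s) \<gamma>" for m
  proof -
    define t where "t = complex_of_real \<alpha> + of_int m"
    have t0: "t \<noteq> 0" using shift_not_Int(1)[OF a] by (simp add: t_def)
    have v_eq: "?v + of_int m = t + of_real \<gamma> / s" by (simp add: t_def)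
    moreover have "t + of_real \<gamma> / s \<noteq> 0" using shift_not_Int(1)[OF v, of m] unfolding v_eq .
    moreover have "t * s + of_real \<gamma> = s * (t + of_real \<gamma> / s)" using s0 by (simp add: field_simps)
    ultimately have "1 / of_real \<gamma> * (1 / t - 1 / (?v + of_int m)) = 1 / t * (1 / (t * s + of_real \<gamma>))"
      using t0 s0 False by (simp add: field_simps)
    thus ?thesis using False by (simp add: pole_term_def t_def)
  qed
  ultimately show ?thesis by simp
qed (simp add: K_def pole_term_def)

text \<open>
  For \<open>s \<rightarrow> 0\<close> in the cone, \<open>\<gamma> / s\<close> moves away from the real axis, to the side opposite to the sign of \<open>\<gamma>\<close>, so
  the second cotangent tends to \<open>\<i> sgn \<gamma>\<close>.
\<close>

lemma shifted_pole_sum_asymptotics: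
  assumes s: "s \<in> upper_cone c" and c: "c > 0"
  shows "norm ((if \<gamma> = 0 then 0 else 1 / complex_of_real \<gamma> *
     (of_real pi * cot (of_real (pi * \<alpha>)) - of_real pi * cot (of_real pi * (of_real \<alpha> + of_real \<gamma> / s))))
     - (of_real pi * cot (of_real (pi * \<alpha>)) * pole_term 0 \<gamma> - \<i> * of_real pi * of_real (1 / \<bar>\<gamma>\<bar>)))
     \<le> 2 * norm s / c * (1 / \<gamma>^2)" (is "norm ?lhs \<le> _")
proof (cases "\<gamma> = 0")
  case False
  define w where "w = complex_of_real pi * (of_real \<alpha> + of_real \<gamma> / s)"
  have s0: "norm s > 0" "c * norm s \<le> Im s" using s by (auto simp: upper_cone_def)
  hence ims: "Im s > 0" using c by (auto intro: less_le_trans[of 0 "c * norm s"])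
  have imw: "Im w = - (pi * \<gamma> * Im s / (norm s)^2)" by (simp add: w_def Im_divide cmod_power2)
  hence absw: "\<bar>Im w\<bar> = pi * \<bar>\<gamma>\<bar> * Im s / (norm s)^2" using ims by (simp add: abs_mult)
  have sgnw: "sgn (Im w) = - sgn \<gamma>" using ims s0 unfolding imw by (simp add: sgn_mult sgn_divide)
  have w0: "Im w \<noteq> 0" using absw False ims s0 by auto
  have "?lhs = - (of_real pi / of_real \<gamma>) * (cot w + of_real (sgn (Im w)) * \<i>)"
    using False unfolding sgnw w_def[symmetric]
    by (simp add: pole_term_def field_simps sgn_if split: if_splits)
  hence "norm ?lhs = pi / \<bar>\<gamma>\<bar> * norm (cot w + of_real (sgn (Im w)) * \<i>)"
    by (simp only: norm_mult norm_minus_cancel norm_divide norm_of_real) simp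
  also have "\<dots> \<le> pi / \<bar>\<gamma>\<bar> * (2 / \<bar>Im w\<bar>)"
    by (intro mult_left_mono norm_cot_plus_minus_ii_le w0) auto
  also have "\<dots> = 2 * (norm s)^2 / Im s * (1 / \<gamma>^2)"
    using False s0 ims unfolding absw by (simp add: field_simps power2_eq_square)
  also have "\<dots> \<le> 2 * norm s / c * (1 / \<gamma>^2)"
  proof (rule mult_right_mono)
    have "2 * norm s * (c * norm s) \<le> 2 * norm s * Im s" using s0 by (intro mult_left_mono) auto
    thus "2 * (norm s)^2 / Im s \<le> 2 * norm s / c" using ims c by (simp add: field_simps power2_eq_square)
  qed simp
  finally show ?thesis .
qed (simp add: pole_term_def)

text \<open>
  The cosecants are expanded into partial fractions and the double series is summed over \<open>m\<close> first. The error
  of each summand over \<open>n\<close> is \<open>O(\<bar>s\<bar> / \<gamma>\<^sup>2)\<close>, uniformly in the cone, so the total error is \<open>O(\<bar>s\<bar>)\<close>.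
\<close>

lemma linear_cosecant_sum:
  assumes \<alpha>: "\<alpha> \<notin> \<int>" and \<beta>: "\<beta> \<notin> \<int>" and c: "c > 0"
    and S2: "((\<lambda>m::int. 1 / complex_of_real (\<alpha> + of_int m) ^ 2) has_sum S2) UNIV"
  shows "\<exists>C. \<forall>s\<in>upper_cone c. \<exists>Q. (cosecant_term 1 \<alpha> \<beta> s has_sum Q) UNIV \<and>
           norm (Q + pole_defect \<beta> * S2 / s - (of_real pi * cot (of_real (pi * \<alpha>)) * reg_cosecant_at_0 \<beta>
              - \<i> * of_real pi * of_real (abs_half_step_sum \<beta>))) \<le> C * norm s"
proof (intro exI[of _ "2 / c * infsum (square_majorant \<beta>) UNIV"] ballI)
  fix s assume s: "s \<in> upper_cone c"
  define t where "t = (\<lambda>m::int. \<alpha> + of_int m)"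
  define g where "g = (\<lambda>n::int. \<beta> + of_int n)"
  have t0: "t m \<noteq> 0" for m using add_of_int_nonzero[OF \<alpha>] by (simp add: t_def)
  have g0: "g n \<noteq> 0" for n using add_of_int_nonzero[OF \<beta>] by (simp add: g_def)
  have s0: "norm s > 0" "c * norm s \<le> Im s" using s by (auto simp: upper_cone_def)
  hence ims: "Im s > 0" using c by (auto intro: less_le_trans[of 0 "c * norm s"])
  define F where "F = (\<lambda>(m, n). 1 / of_real (t m) *
     (pole_term (of_real (t m) * s) (g n) - pole_term (of_real (t m) * s) (g n + 1/2)))"
  define K where "K = (\<lambda>\<gamma>. if \<gamma> = 0 then 0 else 1 / complex_of_real \<gamma> *
     (of_real pi * cot (of_real (pi * \<alpha>)) - of_real pi * cot (of_real pi * (of_real \<alpha> + of_real \<gamma> / s))))"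
  define B where "B = 1 / (c^2 * sqrt (norm s)) + 1 / (c * sqrt (norm s))"
  have B0: "B \<ge> 0" using c by (simp add: B_def)
  have "F summable_on UNIV \<times> UNIV"
  proof (rule abs_summable_summable, rule Infinite_Sum.abs_summable_on_comparison_test')
    show "(\<lambda>(m, n). (B * sesqui_majorant \<alpha> m) * sesqui_majorant \<beta> n) summable_on UNIV \<times> UNIV"
      using B0 by (intro abs_summable_on_product summable_on_cmult_right summable_sesqui_majorant)
                  (auto simp: sesqui_majorant_def)
    fix x :: "int \<times> int"
    obtain m n where x: "x = (m, n)" by (cases x)
    have "norm (F x) = 1 / \<bar>t m\<bar> * norm (pole_term (of_real (t m) * s) (g n) - pole_term (of_real (t m) * s) (g n + 1/2))"
      by (simp add: F_def x norm_mult norm_divide)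
    also have "\<dots> \<le> 1 / \<bar>t m\<bar> * (B / sqrt \<bar>t m\<bar> * sesqui_majorant \<beta> n)"
      using pole_term_difference_le[OF s c t0[of m] g0[of n]]
      by (intro mult_left_mono) (simp_all add: B_def sesqui_majorant_def g_def add_ac)
    also have "\<dots> = B * (\<bar>t m\<bar> powr - (3/2)) * sesqui_majorant \<beta> n"
      by (simp add: powr_three_halves)
    also have "\<dots> \<le> (B * sesqui_majorant \<alpha> m) * sesqui_majorant \<beta> n"
      using B0 by (intro mult_right_mono mult_left_mono) (auto simp: sesqui_majorant_def t_def)
    finally show "norm (F x) \<le> (case x of (m, n) \<Rightarrow> (B * sesqui_majorant \<alpha> m) * sesqui_majorant \<beta> n)"
      by (simp add: x)
  qed
  then obtain S where S: "(F has_sum S) (UNIV \<times> UNIV)" by (auto simp: summable_on_def)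
  have rows: "((\<lambda>m. cosecant_term 1 \<alpha> \<beta> s m + pole_defect \<beta> / s * (1 / of_real (t m)^2)) has_sum S) UNIV"
  proof (rule has_sum_SigmaD[OF S])
    fix m
    have "Im (of_real (t m) * s) \<noteq> 0" using ims t0[of m] by simp
    from has_sum_cmult_right[OF regularised_cosecant_series[OF \<beta> this], of "1 / of_real (t m)"]
    have "((\<lambda>n. F (m, n)) has_sum 1 / of_real (t m) * (2 * of_real pi /
        sin (2 * of_real pi * (of_real (t m) * s + of_real \<beta>)) + pole_defect \<beta> / (of_real (t m) * s))) UNIV"
      by (simp add: F_def g_def add_ac)
    also have "1 / of_real (t m) * (2 * of_real pi /
        sin (2 * of_real pi * (of_real (t m) * s + of_real \<beta>)) + pole_defect \<beta> / (of_real (t m) * s))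
       = cosecant_term 1 \<alpha> \<beta> s m + pole_defect \<beta> / s * (1 / of_real (t m)^2)"
      unfolding distrib_left[of "1 / of_real (t m)"] cosecant_term_def
      by (simp add: t_def power2_eq_square)
    finally show "((\<lambda>n. F (m, n)) has_sum (cosecant_term 1 \<alpha> \<beta> s m + pole_defect \<beta> / s * (1 / of_real (t m)^2))) UNIV" .
  qed
  define Q where "Q = S - pole_defect \<beta> / s * S2"
  have Q: "(cosecant_term 1 \<alpha> \<beta> s has_sum Q) UNIV"
    using has_sum_diff[OF rows has_sum_cmult_right[OF S2, of "pole_defect \<beta> / s"]] by (simp add: t_def Q_def)
  have columns: "((\<lambda>n. K (g n) - K (g n + 1/2)) has_sum S) UNIV"
  proof (rule has_sum_SigmaD[OF S[unfolded has_sum_swap[of F]]])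
    fix n
    have "((\<lambda>m. 1 / of_real (t m) * pole_term (of_real (t m) * s) (g n) -
        1 / of_real (t m) * pole_term (of_real (t m) * s) (g n + 1/2)) has_sum (K (g n) - K (g n + 1/2))) UNIV"
      unfolding K_def t_def by (intro has_sum_diff shifted_pole_sum \<alpha> ims)
    thus "((\<lambda>m. case (n, m) of (x, y) \<Rightarrow> F (y, x)) has_sum (K (g n) - K (g n + 1/2))) UNIV"
      by (simp add: F_def right_diff_distrib)
  qed
  define H where "H = (\<lambda>\<gamma>. of_real pi * cot (of_real (pi * \<alpha>)) * pole_term 0 \<gamma> - \<i> * of_real pi * of_real (1 / \<bar>\<gamma>\<bar>))"
  define l where "l = of_real pi * cot (of_real (pi * \<alpha>)) * reg_cosecant_at_0 \<beta>
              - \<i> * of_real pi * of_real (abs_half_step_sum \<beta>)"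
  have "((\<lambda>n. of_real pi * cot (of_real (pi * \<alpha>)) * (pole_term 0 (\<beta> + of_int n) - pole_term 0 (\<beta> + 1/2 + of_int n))
      - \<i> * of_real pi * of_real (1 / \<bar>\<beta> + of_int n\<bar> - 1 / \<bar>\<beta> + 1/2 + of_int n\<bar>)) has_sum l) UNIV"
    unfolding l_def
    by (intro has_sum_diff has_sum_cmult_right has_sum_reg_cosecant_at_0 has_sum_of_real has_sum_abs_half_step_sum \<beta>)
  also have "(\<lambda>n::int. of_real pi * cot (of_real (pi * \<alpha>)) * (pole_term 0 (\<beta> + of_int n) - pole_term 0 (\<beta> + 1/2 + of_int n))
      - \<i> * of_real pi * of_real (1 / \<bar>\<beta> + of_int n\<bar> - 1 / \<bar>\<beta> + 1/2 + of_int n\<bar>)) = (\<lambda>n. H (g n) - H (g n + 1/2))"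
    by (simp add: H_def g_def algebra_simps)
  finally have limit: "((\<lambda>n. H (g n) - H (g n + 1/2)) has_sum l) UNIV" .
  have "norm (S - l) \<le> 2 * norm s / c * infsum (square_majorant \<beta>) UNIV"
  proof (rule norm_infsum_le[OF has_sum_diff[OF columns limit]])
    show "((\<lambda>n. 2 * norm s / c * square_majorant \<beta> n) has_sum 2 * norm s / c * infsum (square_majorant \<beta>) UNIV) UNIV"
      by (intro has_sum_cmult_right has_sum_infsum summable_square_majorant)
    fix n
    have "norm (K (g n) - K (g n + 1/2) - (H (g n) - H (g n + 1/2)))
        = norm ((K (g n) - H (g n)) - (K (g n + 1/2) - H (g n + 1/2)))" by (simp add: algebra_simps)
    also have "\<dots> \<le> norm (K (g n) - H (g n)) + norm (K (g n + 1/2) - H (g n + 1/2))" by (rule norm_triangle_ineq4)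
    also have "\<dots> \<le> 2 * norm s / c * (1 / (g n)^2) + 2 * norm s / c * (1 / (g n + 1/2)^2)"
      unfolding K_def H_def by (intro add_mono shifted_pole_sum_asymptotics[OF s c])
    also have "\<dots> = 2 * norm s / c * square_majorant \<beta> n"
      unfolding square_majorant_def distrib_left by (simp add: g_def add_ac)
    finally show "norm (K (g n) - K (g n + 1/2) - (H (g n) - H (g n + 1/2))) \<le> 2 * norm s / c * square_majorant \<beta> n" .
  qed
  thus "\<exists>Q. (cosecant_term 1 \<alpha> \<beta> s has_sum Q) UNIV \<and>
           norm (Q + pole_defect \<beta> * S2 / s - (of_real pi * cot (of_real (pi * \<alpha>)) * reg_cosecant_at_0 \<beta>
              - \<i> * of_real pi * of_real (abs_half_step_sum \<beta>))) \<le> 2 / c * infsum (square_majorant \<beta>) UNIV * norm s"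
    using Q by (intro exI[of _ Q]) (simp add: Q_def l_def mult_ac)
qed

section \<open>Odd residue classes and trigonometric sums\<close>

lemma finite_odds_upto [simp]: "finite (odds_upto m)"
  by (rule finite_subset[of _ "{1..m}"]) (auto simp: odds_upto_def)

text \<open>
  Multiplication by \<open>r\<close> permutes the odd residue classes modulo \<open>2 p\<close>. The case \<open>r = 1\<close> is the usual splitting
  of the odd integers into classes.
\<close>

lemma bij_betw_odd_residue_classes:
  fixes r p :: int
  assumes r: "odd r" and p: "p > 0" and rp: "coprime r p"
  shows "bij_betw (\<lambda>(a, n). a * r + 2 * p * n) (odds_upto (2 * p - 1) \<times> UNIV) {l. odd l}"
proof -
  have cop: "coprime r (2 * p)" using r rp by (simp add: coprime_commute)
  show ?thesis
  proof (rule bij_betw_imageI)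
    show "inj_on (\<lambda>(a, n). a * r + 2 * p * n) (odds_upto (2 * p - 1) \<times> UNIV)"
    proof (rule inj_onI, clarify)
      fix a n a' n' assume a: "a \<in> odds_upto (2 * p - 1)" "a' \<in> odds_upto (2 * p - 1)"
        and eq: "a * r + 2 * p * n = a' * r + 2 * p * n'"
      have "(a - a') * r = 2 * p * (n' - n)" using eq by (simp add: algebra_simps)
      hence "2 * p dvd (a - a') * r" by simp
      hence "2 * p dvd a - a'" using cop by (simp add: coprime_dvd_mult_left_iff coprime_commute)
      moreover have "\<bar>a - a'\<bar> < 2 * p" using a by (auto simp: odds_upto_def)
      ultimately have "a = a'" using p by (metis dvd_imp_le_int abs_of_pos eq_iff_diff_eq_0 not_less mult_pos_pos zero_less_numeral)
      thus "a = a' \<and> n = n'" using eq p by simp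
    qed
    show "(\<lambda>(a, n). a * r + 2 * p * n) ` (odds_upto (2 * p - 1) \<times> UNIV) = {l. odd l}"
    proof (intro subset_antisym subsetI)
      fix l assume "l \<in> (\<lambda>(a, n). a * r + 2 * p * n) ` (odds_upto (2 * p - 1) \<times> UNIV)"
      thus "l \<in> {l. odd l}" using r by (auto simp: odds_upto_def)
    next
      fix l :: int assume "l \<in> {l. odd l}"
      hence l: "odd l" by simp
      obtain u v where uv: "u * r + v * (2 * p) = 1"
        using bezout_int[of r "2 * p"] cop by (auto simp: coprime_iff_gcd_eq_1)
      define a where "a = (l * u) mod (2 * p)"
      have split: "l * u = 2 * p * (l * u div (2 * p)) + a" by (simp add: a_def)
      have "l = l * (u * r + v * (2 * p))" by (simp add: uv)
      also have "\<dots> = (l * u) * r + 2 * p * (l * v)" by (simp add: algebra_simps)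
      also have "\<dots> = a * r + 2 * p * ((l * u div (2 * p)) * r + l * v)"
        by (subst split) (simp add: algebra_simps)
      finally have eq: "l = a * r + 2 * p * ((l * u div (2 * p)) * r + l * v)" .
      have "odd a"
      proof
        assume "even a"
        hence "even (a * r + 2 * p * ((l * u div (2 * p)) * r + l * v))" by simp
        thus False using l eq by metis
      qed
      moreover have "0 \<le> a" "a < 2 * p" using p by (simp_all add: a_def)
      ultimately have "a \<in> odds_upto (2 * p - 1)" by (auto simp: odds_upto_def elim!: oddE)
      thus "l \<in> (\<lambda>(a, n). a * r + 2 * p * n) ` (odds_upto (2 * p - 1) \<times> UNIV)"
        using eq by (intro image_eqI[of _ _ "(a, (l * u div (2 * p)) * r + l * v)"]) auto
    qed
  qed
qed

lemma has_sum_odd_residue_classes: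
  fixes r p :: int and f :: "int \<Rightarrow> 'a::{topological_comm_monoid_add, t3_space}"
  assumes r: "odd r" and p: "p > 0" and rp: "coprime r p"
    and f: "(f has_sum S) {l. odd l}"
    and g: "\<And>a. a \<in> odds_upto (2 * p - 1) \<Longrightarrow> ((\<lambda>n. f (a * r + 2 * p * n)) has_sum g a) UNIV"
  shows "(\<Sum>a\<in>odds_upto (2 * p - 1). g a) = S"
proof -
  have "((\<lambda>x. f (case x of (a, n) \<Rightarrow> a * r + 2 * p * n)) has_sum S) (odds_upto (2 * p - 1) \<times> UNIV)"
    using f by (simp only: has_sum_reindex_bij_betw[OF bij_betw_odd_residue_classes[OF r p rp]])
  from has_sum_SigmaD[OF this, of g] g have "(g has_sum S) (odds_upto (2 * p - 1))" by simp
  thus ?thesis by (metis finite_odds_upto has_sum_finite has_sum_unique)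
qed

lemma has_sum_odd_iff:
  fixes f :: "int \<Rightarrow> 'a::{topological_comm_monoid_add, t2_space}"
  shows "(f has_sum S) {l. odd l} \<longleftrightarrow> ((\<lambda>j. f (2 * j + 1)) has_sum S) UNIV"
proof -
  have "bij_betw (\<lambda>j. 2 * j + 1) UNIV {l::int. odd l}"
    by (rule bij_betwI[where g = "\<lambda>l. l div 2"]) auto
  from has_sum_reindex_bij_betw[OF this, of f S] show ?thesis by simp
qed

lemma half_odd_residue_in_Ints_iff:
  fixes r p a :: int
  assumes r: "odd r" and p: "p > 0" "odd p" and rp: "coprime r p" and a: "a \<in> odds_upto (2 * p - 1)"
  shows "of_int (a * r) / (2 * of_int p) \<notin> (\<int> :: real set)"
    and "of_int (a * r) / (2 * of_int p) + 1/2 \<in> (\<int> :: real set) \<longleftrightarrow> a = p"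
proof -
  have ar: "odd (a * r)" using r a by (simp add: odds_upto_def)
  show "of_int (a * r) / (2 * of_int p) \<notin> (\<int> :: real set)"
  proof
    assume "of_int (a * r) / (2 * of_int p) \<in> (\<int> :: real set)"
    then obtain k where "of_int (a * r) / (2 * of_int p) = (of_int k :: real)" by (auto elim!: Ints_cases)
    hence "of_int (a * r) = (of_int (2 * p * k) :: real)" using p by (simp add: field_simps)
    hence "a * r = 2 * p * k" by (simp only: of_int_eq_iff)
    thus False using ar by simp
  qed
  show "of_int (a * r) / (2 * of_int p) + 1/2 \<in> (\<int> :: real set) \<longleftrightarrow> a = p"
  proof
    assume "of_int (a * r) / (2 * of_int p) + 1/2 \<in> (\<int> :: real set)"
    then obtain k where "of_int (a * r) / (2 * of_int p) + 1/2 = (of_int k :: real)" by (auto elim!: Ints_cases)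
    hence "of_int (a * r + p) = (of_int (2 * p * k) :: real)" using p by (simp add: field_simps)
    hence "a * r + p = 2 * p * k" by (simp only: of_int_eq_iff)
    hence "a * r = p * (2 * k - 1)" by (simp add: algebra_simps)
    hence "p dvd a * r" by simp
    hence "p dvd a" using rp by (simp add: coprime_dvd_mult_left_iff coprime_commute)
    then obtain m where m: "a = p * m" by auto
    have "0 < a" "a < p * 2" using a by (simp_all add: odds_upto_def)
    hence "0 < p * m" "p * m < p * 2" by (simp_all only: m)
    hence "0 < m" using p by (simp add: zero_less_mult_iff)
    moreover have "m < 2" using \<open>p * m < p * 2\<close> p by (simp only: mult_less_cancel_left_pos)
    ultimately show "a = p" using m by simp
  next
    assume "a = p"
    obtain k where "r = 2 * k + 1" using r by (elim oddE)
    hence "of_int (a * r) / (2 * of_int p) + 1/2 = (of_int (k + 1) :: real)"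
      using p \<open>a = p\<close> by (simp add: field_simps)
    thus "of_int (a * r) / (2 * of_int p) + 1/2 \<in> (\<int> :: real set)" by (metis Ints_of_int)
  qed
qed

lemma inverse_square_series_real:
  fixes \<alpha> :: real
  assumes "\<alpha> \<notin> \<int>"
  shows "((\<lambda>m::int. 1 / (\<alpha> + of_int m) ^ 2) has_sum (pi ^ 2 / sin (pi * \<alpha>) ^ 2)) UNIV"
proof -
  have "complex_of_real \<alpha> \<notin> \<int>"
    using assms by (metis Ints_cases Ints_of_int of_real_eq_iff of_real_of_int_eq)
  from inverse_square_series[OF this]
  have "((\<lambda>m::int. complex_of_real (1 / (\<alpha> + of_int m) ^ 2)) has_sum of_real (pi ^ 2 / sin (pi * \<alpha>) ^ 2)) UNIV"
    by (simp add: sin_of_real flip: of_real_mult)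
  thus ?thesis by (simp only: has_sum_of_real_iff)
qed

lemma inverse_odd_square_sum: "((\<lambda>l::int. 1 / (of_int l :: real) ^ 2) has_sum pi ^ 2 / 4) {l. odd l}"
proof -
  have "(1/2::real) \<notin> \<int>" using fraction_not_in_Ints[of 2 1] by auto
  from has_sum_cmult_right[OF inverse_square_series_real[OF this], of "1/4"]
  have "((\<lambda>m::int. 1/4 * (1 / (1/2 + of_int m) ^ 2)) has_sum (pi ^ 2 / 4 :: real)) UNIV" by simp
  also have "(\<lambda>m::int. 1/4 * (1 / (1/2 + of_int m) ^ 2)) = (\<lambda>m. 1 / (of_int (2 * m + 1) :: real) ^ 2)"
    by (rule ext) (simp add: power2_eq_square divide_simps algebra_simps)
  finally show ?thesis unfolding has_sum_odd_iff .
qed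

text \<open>
  The even integers contribute a quarter of the whole sum, so the odd ones, known from \<open>\<alpha> = 1/2\<close>, are three
  quarters of it. The summand at 0 vanishes by \<open>1 / 0 = 0\<close>.
\<close>

lemma inverse_int_square_sum: "((\<lambda>n::int. 1 / (of_int n :: real) ^ 2) has_sum pi ^ 2 / 3) UNIV"
proof -
  let ?f = "\<lambda>n::int. 1 / (of_int n :: real) ^ 2"
  have "?f summable_on UNIV" using summable_on_int_inverse_power[of 2 "0::real"] by simp
  then obtain Z where Z: "(?f has_sum Z) UNIV" by (auto simp: summable_on_def)
  have "bij_betw (\<lambda>j. 2 * j) UNIV {l::int. even l}"
    by (rule bij_betwI[where g = "\<lambda>l. l div 2"]) auto
  from has_sum_reindex_bij_betw[OF this, of ?f "1/4 * Z"]
  have "(?f has_sum (1/4 * Z)) {l. even l}"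
    using has_sum_cmult_right[OF Z, of "1/4"] by (simp add: power_mult_distrib)
  from has_sum_Un_disjoint[OF this inverse_odd_square_sum]
  have "(?f has_sum (1/4 * Z + pi ^ 2 / 4)) ({l. even l} \<union> {l. odd l})" by auto
  moreover have "{l. even l} \<union> {l. odd l} = (UNIV :: int set)" by auto
  ultimately have "Z = 1/4 * Z + pi ^ 2 / 4" using Z has_sum_unique by fastforce
  hence "Z = pi ^ 2 / 3" by simp
  from Z[unfolded this] show ?thesis .
qed

lemma has_sum_int_shift:
  "((\<lambda>n::int. f (n + k)) has_sum S) UNIV \<longleftrightarrow> (f has_sum S) UNIV"
  by (rule has_sum_reindex_bij_betw[of "\<lambda>n. n + k"]) (rule bij_betwI[where g = "\<lambda>n. n - k"], auto)

abbreviation half_angle :: "int \<Rightarrow> int \<Rightarrow> int \<Rightarrow> real" where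
  "half_angle r p a \<equiv> pi * (of_int (a * r) / (2 * of_int p))"

context
  fixes r p :: int
  assumes r: "odd r" and p: "p > 0" and p_odd: "odd p" and rp: "coprime r p"
begin

lemma p_in_odds_upto: "p \<in> odds_upto (2 * p - 1)"
  using p p_odd by (simp add: odds_upto_def)

lemma sum_cosecant_square:
  "(\<Sum>a\<in>odds_upto (2 * p - 1). 1 / sin (half_angle r p a) ^ 2) = of_int p ^ 2"
proof -
  have "(\<Sum>a\<in>odds_upto (2 * p - 1). 1 / (2 * of_int p) ^ 2 * (pi ^ 2 / sin (half_angle r p a) ^ 2)) = pi ^ 2 / 4"
  proof (rule has_sum_odd_residue_classes[OF r p rp inverse_odd_square_sum])
    fix a assume a: "a \<in> odds_upto (2 * p - 1)"
    have "((\<lambda>n::int. 1 / (2 * of_int p) ^ 2 * (1 / (of_int (a * r) / (2 * of_int p) + of_int n) ^ 2)) has_sum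
      1 / (2 * of_int p) ^ 2 * (pi ^ 2 / sin (half_angle r p a) ^ 2)) UNIV"
      by (intro has_sum_cmult_right inverse_square_series_real half_odd_residue_in_Ints_iff[OF r p p_odd rp a])
    also have "(\<lambda>n::int. 1 / (2 * of_int p) ^ 2 * (1 / (of_int (a * r) / (2 * of_int p) + of_int n) ^ 2)) =
        (\<lambda>n. 1 / (of_int (a * r + 2 * p * n) :: real) ^ 2)"
    proof
      fix n
      have "(2 * of_int p) ^ 2 * (of_int (a * r) / (2 * of_int p) + of_int n) ^ 2 = (of_int (a * r + 2 * p * n) :: real) ^ 2"
        using p by (simp add: power_mult_distrib[symmetric] field_simps)
      thus "1 / (2 * of_int p) ^ 2 * (1 / (of_int (a * r) / (2 * of_int p) + of_int n) ^ 2) = 1 / (of_int (a * r + 2 * p * n) :: real) ^ 2"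
        by (metis times_divide_times_eq mult_1)
    qed
    finally show "((\<lambda>n. 1 / (of_int (a * r + 2 * p * n) :: real) ^ 2) has_sum
        1 / (2 * of_int p) ^ 2 * (pi ^ 2 / sin (half_angle r p a) ^ 2)) UNIV" .
  qed
  also have "(\<Sum>a\<in>odds_upto (2 * p - 1). 1 / (2 * of_int p) ^ 2 * (pi ^ 2 / sin (half_angle r p a) ^ 2)) =
      pi ^ 2 / (4 * of_int p ^ 2) * (\<Sum>a\<in>odds_upto (2 * p - 1). 1 / sin (half_angle r p a) ^ 2)"
    by (simp add: sum_distrib_left power_mult_distrib)
  finally show ?thesis using p by (simp add: field_simps)
qed

text \<open>
  A cosine is a sine shifted by a quarter period, which moves the odd integers \<open>l\<close> to the even integers \<open>l + p\<close>.
  The class of \<open>a = p\<close> becomes the multiples of \<open>2 p\<close>; its secant is infinite and its share has to be subtracted.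
\<close>

lemma sum_secant_square:
  "(\<Sum>a\<in>odds_upto (2 * p - 1) - {p}. 1 / cos (half_angle r p a) ^ 2) = (of_int p ^ 2 - 1) / 3"
proof -
  define g where "g = (\<lambda>a. if a = p then pi ^ 2 / 3 else pi ^ 2 / cos (half_angle r p a) ^ 2)"
  have "((\<lambda>m::int. 1/4 * (1 / (of_int m :: real) ^ 2)) has_sum (1/4 * (pi ^ 2 / 3))) UNIV"
    by (intro has_sum_cmult_right inverse_int_square_sum)
  hence "((\<lambda>j::int. 1/4 * (1 / (of_int (j + (p + 1) div 2) :: real) ^ 2)) has_sum (1/4 * (pi ^ 2 / 3))) UNIV"
    by (subst has_sum_int_shift[of "\<lambda>m. 1/4 * (1 / (of_int m :: real) ^ 2)"])
  also have "(\<lambda>j::int. 1/4 * (1 / (of_int (j + (p + 1) div 2) :: real) ^ 2)) =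
      (\<lambda>j. 1 / (of_int (2 * j + 1 + p) :: real) ^ 2)"
  proof
    fix j
    have "2 * j + 1 + p = 2 * (j + (p + 1) div 2)" using p_odd by (elim oddE) simp
    thus "1/4 * (1 / (of_int (j + (p + 1) div 2) :: real) ^ 2) = 1 / (of_int (2 * j + 1 + p) :: real) ^ 2"
      by (simp only: of_int_mult power_mult_distrib) simp
  qed
  finally have evens: "((\<lambda>l. 1 / (of_int (l + p) :: real) ^ 2) has_sum (1/4 * (pi ^ 2 / 3))) {l. odd l}"
    unfolding has_sum_odd_iff .
  have "(\<Sum>a\<in>odds_upto (2 * p - 1). 1 / (2 * of_int p) ^ 2 * g a) = 1/4 * (pi ^ 2 / 3)"
  proof (rule has_sum_odd_residue_classes[OF r p rp evens])
    fix a assume a: "a \<in> odds_upto (2 * p - 1)"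
    have "((\<lambda>n::int. 1 / (of_int (a * r) / (2 * of_int p) + 1/2 + of_int n) ^ 2) has_sum g a) UNIV"
    proof (cases "a = p")
      case True
      obtain k where "r = 2 * k + 1" using r by (elim oddE)
      hence "of_int (a * r) / (2 * of_int p) + 1/2 = (of_int (k + 1) :: real)"
        using p True by (simp add: field_simps)
      thus ?thesis using True inverse_int_square_sum
          has_sum_int_shift[of "\<lambda>m. 1 / (of_int m :: real) ^ 2" "k + 1"] by (simp add: g_def add_ac)
    next
      case False
      have "sin (pi * (of_int (a * r) / (2 * of_int p) + 1/2)) = cos (half_angle r p a)"
        by (simp add: distrib_left sin_add)
      thus ?thesis using inverse_square_series_real[of "of_int (a * r) / (2 * of_int p) + 1/2"]
          half_odd_residue_in_Ints_iff(2)[OF r p p_odd rp a] False by (simp add: g_def)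
    qed
    from has_sum_cmult_right[OF this, of "1 / (2 * of_int p) ^ 2"]
    have "((\<lambda>n::int. 1 / (2 * of_int p) ^ 2 * (1 / (of_int (a * r) / (2 * of_int p) + 1/2 + of_int n) ^ 2)) has_sum
       1 / (2 * of_int p) ^ 2 * g a) UNIV" .
    also have "(\<lambda>n::int. 1 / (2 * of_int p) ^ 2 * (1 / (of_int (a * r) / (2 * of_int p) + 1/2 + of_int n) ^ 2)) =
        (\<lambda>n. 1 / (of_int (a * r + 2 * p * n + p) :: real) ^ 2)"
    proof
      fix n
      have "(2 * of_int p) ^ 2 * (of_int (a * r) / (2 * of_int p) + 1/2 + of_int n) ^ 2 = (of_int (a * r + 2 * p * n + p) :: real) ^ 2"
        using p by (simp add: power_mult_distrib[symmetric] field_simps)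
      thus "1 / (2 * of_int p) ^ 2 * (1 / (of_int (a * r) / (2 * of_int p) + 1/2 + of_int n) ^ 2) = 1 / (of_int (a * r + 2 * p * n + p) :: real) ^ 2"
        by (metis times_divide_times_eq mult_1)
    qed
    finally show "((\<lambda>n. 1 / (of_int (a * r + 2 * p * n + p) :: real) ^ 2) has_sum 1 / (2 * of_int p) ^ 2 * g a) UNIV" .
  qed
  hence "(\<Sum>a\<in>odds_upto (2 * p - 1). g a) / (2 * of_int p) ^ 2 = pi ^ 2 / 12"
    by (simp add: sum_divide_distrib)
  hence "(\<Sum>a\<in>odds_upto (2 * p - 1). g a) = pi ^ 2 / 3 * of_int p ^ 2" using p by (simp add: field_simps)
  also have "(\<Sum>a\<in>odds_upto (2 * p - 1). g a) = g p + (\<Sum>a\<in>odds_upto (2 * p - 1) - {p}. g a)"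
    by (intro sum.remove p_in_odds_upto) simp
  also have "(\<Sum>a\<in>odds_upto (2 * p - 1) - {p}. g a) = pi ^ 2 * (\<Sum>a\<in>odds_upto (2 * p - 1) - {p}. 1 / cos (half_angle r p a) ^ 2)"
    unfolding sum_distrib_left by (intro sum.cong) (auto simp: g_def)
  finally have "pi ^ 2 * ((\<Sum>a\<in>odds_upto (2 * p - 1) - {p}. 1 / cos (half_angle r p a) ^ 2)) = pi ^ 2 * ((of_int p ^ 2 - 1) / 3)"
    by (simp add: g_def algebra_simps)
  thus ?thesis by simp
qed

lemma half_angle_nonzero:
  assumes a: "a \<in> odds_upto (2 * p - 1)"
  shows "sin (half_angle r p a) \<noteq> 0" and "a \<noteq> p \<Longrightarrow> cos (half_angle r p a) \<noteq> 0"
proof -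
  note I = half_odd_residue_in_Ints_iff[OF r p p_odd rp a]
  show "sin (half_angle r p a) \<noteq> 0" using I(1) sin_times_pi_eq_0[of "of_int (a * r) / (2 * of_int p)"]
    by (simp add: mult.commute)
  assume "a \<noteq> p"
  hence "sin ((of_int (a * r) / (2 * of_int p) + 1/2) * pi) \<noteq> 0" using I(2) unfolding sin_times_pi_eq_0 by simp
  moreover have "sin ((x + 1/2) * pi) = cos (pi * x)" for x
    by (subst mult.commute) (simp add: distrib_left sin_add)
  ultimately show "cos (half_angle r p a) \<noteq> 0" by metis
qed

lemma sum_odds_upto_fold:
  fixes f :: "int \<Rightarrow> 'a::real_vector"
  assumes "\<And>a. f (2 * p - a) = f a"
  shows "(\<Sum>a\<in>odds_upto (2 * p - 1) - {p}. f a) = 2 *\<^sub>R (\<Sum>a\<in>odds_upto (p - 2). f a)"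
proof -
  have split: "odds_upto (2 * p - 1) - {p} = odds_upto (p - 2) \<union> (\<lambda>a. 2 * p - a) ` odds_upto (p - 2)"
  proof (intro equalityI subsetI)
    fix a assume a: "a \<in> odds_upto (2 * p - 1) - {p}"
    hence "a \<noteq> p - 1" "a \<noteq> p + 1" using p_odd by (auto simp: odds_upto_def)
    show "a \<in> odds_upto (p - 2) \<union> (\<lambda>a. 2 * p - a) ` odds_upto (p - 2)"
    proof (cases "a < p")
      case True
      thus ?thesis using a \<open>a \<noteq> p - 1\<close> by (auto simp: odds_upto_def)
    next
      case False
      hence "2 * p - a \<in> odds_upto (p - 2)" using a \<open>a \<noteq> p + 1\<close> by (auto simp: odds_upto_def)
      thus ?thesis by (intro UnI2 image_eqI[of _ _ "2 * p - a"]) auto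
    qed
  qed (use p_odd p in \<open>auto simp: odds_upto_def\<close>)
  have "(\<Sum>a\<in>odds_upto (2 * p - 1) - {p}. f a) =
      (\<Sum>a\<in>odds_upto (p - 2). f a) + (\<Sum>a\<in>(\<lambda>a. 2 * p - a) ` odds_upto (p - 2). f a)"
    unfolding split by (rule sum.union_disjoint) (simp, simp, auto simp: odds_upto_def)
  also have "(\<Sum>a\<in>(\<lambda>a. 2 * p - a) ` odds_upto (p - 2). f a) = (\<Sum>a\<in>odds_upto (p - 2). f a)"
    by (subst sum.reindex) (auto simp: inj_on_def assms)
  finally show ?thesis by (simp add: scaleR_2)
qed

lemma half_angle_reflect:
  "sin (half_angle r p (2 * p - a)) = sin (half_angle r p a)" "cos (half_angle r p (2 * p - a)) = - cos (half_angle r p a)"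
proof -
  have "half_angle r p (2 * p - a) = of_int r * pi - half_angle r p a" using p by (simp add: field_simps)
  moreover have "sin (of_int r * pi) = 0" by (metis Ints_of_int sin_times_pi_eq_0)
  moreover have "cos (of_int r * pi) = -1"
  proof -
    obtain k where "r = 2 * k + 1" using r by (elim oddE)
    hence "of_int r * pi = 2 * pi * of_int k + pi" by (simp add: algebra_simps)
    thus ?thesis by (simp add: cos_int_2pin)
  qed
  ultimately show "sin (half_angle r p (2 * p - a)) = sin (half_angle r p a)" "cos (half_angle r p (2 * p - a)) = - cos (half_angle r p a)"
    by (simp_all add: sin_diff cos_diff)
qed

end

section \<open>The harmonic constant and the cotangent sum\<close>

lemma tendsto_inverse_double: "(\<lambda>i. 1 / (2 * real i)) \<longlonglongrightarrow> 0"
proof -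
  have "(\<lambda>i. 1 / 2 * (1 / real i)) \<longlonglongrightarrow> 1 / 2 * 0" by (intro tendsto_intros lim_1_over_n)
  thus ?thesis by simp
qed

text \<open>
  The convention \<open>1 / 0 = 0\<close> makes the boundary terms of the telescoping series vanish on both sides of 0.
\<close>

lemma int_half_steps_telescope:
  "((\<lambda>j::int. 1 / \<bar>2 * of_int (j + k)\<bar> - 1 / \<bar>2 * of_int (j + k) + 2\<bar> :: real) has_sum 0) UNIV"
proof -
  define h where "h = (\<lambda>i::nat. 1 / (2 * real i))"
  have "h \<longlonglongrightarrow> 0" unfolding h_def by (rule tendsto_inverse_double)
  hence sums: "(\<lambda>i. h i - h (Suc i)) sums 0"
    using telescope_sums'[of h 0] by (simp add: h_def)
  have "eventually (\<lambda>i. h i - h (Suc i) \<ge> 0) sequentially"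
    using eventually_gt_at_top[of 0] by eventually_elim (simp add: h_def field_simps)
  from sums_nonneg_imp_has_sum_strong[OF sums this]
  have half: "((\<lambda>i. h i - h (Suc i)) has_sum 0) UNIV" .
  have "((\<lambda>j::int. 1 / \<bar>2 * of_int j\<bar> - 1 / \<bar>2 * of_int j + 2\<bar> :: real) has_sum (0 + - 0)) UNIV"
  proof (rule has_sum_int_halves)
    show "((\<lambda>n. 1 / \<bar>2 * of_int (int n)\<bar> - 1 / \<bar>2 * of_int (int n) + 2\<bar> :: real) has_sum 0) UNIV"
      using half by (simp add: h_def algebra_simps)
    have "1 / \<bar>2 * of_int (- int n - 1)\<bar> - 1 / \<bar>2 * of_int (- int n - 1) + 2\<bar> = - (h n - h (Suc n))" for n
      by (simp add: h_def algebra_simps)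
    thus "((\<lambda>n. 1 / \<bar>2 * of_int (- int n - 1)\<bar> - 1 / \<bar>2 * of_int (- int n - 1) + 2\<bar> :: real) has_sum - 0) UNIV"
      using has_sum_uminusI[OF half] by simp
  qed
  thus ?thesis
    using has_sum_int_shift[of "\<lambda>j. 1 / \<bar>2 * of_int j\<bar> - 1 / \<bar>2 * of_int j + 2\<bar> :: real" k 0] by simp
qed

text \<open>
  Any even shift between the odd and the even denominators gives the same value, since shifting by one more
  step adds a telescoping series with sum 0. For \<open>k = 0\<close> the indices \<open>j \<ge> 0\<close> give the alternating harmonic series, and
  so do the indices \<open>j < 0\<close> after subtraction of a telescoping series.
\<close>

lemma alternating_harmonic_int_sum:
  "((\<lambda>j::int. 1 / \<bar>2 * of_int j + 1\<bar> - 1 / \<bar>2 * of_int j + 2 + 2 * of_nat k\<bar> :: real) has_sum 2 * ln 2) UNIV"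
proof (induction k)
  case 0
  have nn: "((\<lambda>i. 1 / (2 * real i + 1) - 1 / (2 * real i + 2)) has_sum ln 2) UNIV"
  proof (rule sums_nonneg_imp_has_sum)
    show "(\<lambda>i. 1 / (2 * real i + 1) - 1 / (2 * real i + 2)) sums ln 2"
      using alternating_harmonic_series_sums' by (simp add: inverse_eq_divide add_ac)
  qed (simp add: field_simps)
  have tel: "((\<lambda>i. 1 / (2 * real i) - 1 / (2 * real i + 2)) has_sum 0) UNIV"
  proof (rule sums_nonneg_imp_has_sum_strong)
    from telescope_sums'[OF tendsto_inverse_double] show "(\<lambda>i. 1 / (2 * real i) - 1 / (2 * real i + 2)) sums 0"
      by (simp add: algebra_simps)
    show "eventually (\<lambda>i. 1 / (2 * real i) - 1 / (2 * real i + 2) \<ge> 0) sequentially"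
      using eventually_gt_at_top[of 0] by eventually_elim (simp add: field_simps)
  qed
  have "((\<lambda>j::int. 1 / \<bar>2 * of_int j + 1\<bar> - 1 / \<bar>2 * of_int j + 2\<bar> :: real) has_sum (ln 2 + (ln 2 - 0))) UNIV"
  proof (rule has_sum_int_halves)
    show "((\<lambda>n. 1 / \<bar>2 * of_int (int n) + 1\<bar> - 1 / \<bar>2 * of_int (int n) + 2\<bar> :: real) has_sum ln 2) UNIV"
      using nn by (simp add: add_ac)
    have "1 / \<bar>2 * of_int (- int n - 1) + 1\<bar> - 1 / \<bar>2 * of_int (- int n - 1) + 2\<bar> =
        (1 / (2 * real n + 1) - 1 / (2 * real n + 2)) - (1 / (2 * real n) - 1 / (2 * real n + 2))" for n
    proof -
      have "\<bar>2 * of_int (- int n - 1) + 1\<bar> = 2 * real n + 1" "\<bar>2 * of_int (- int n - 1) + 2\<bar> = 2 * real n" by simp_all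
      thus ?thesis by simp
    qed
    thus "((\<lambda>n. 1 / \<bar>2 * of_int (- int n - 1) + 1\<bar> - 1 / \<bar>2 * of_int (- int n - 1) + 2\<bar> :: real) has_sum (ln 2 - 0)) UNIV"
      using has_sum_diff[OF nn tel] by simp
  qed
  thus ?case by simp
next
  case (Suc k)
  from has_sum_add[OF Suc.IH int_half_steps_telescope[of "1 + int k"]]
  show ?case by (simp add: algebra_simps)
qed

context
  fixes r p :: int
  assumes r: "odd r" and p: "p > 0" and p_odd: "odd p" and rp: "coprime r p"
begin

text \<open>
  Over all residue classes the odd integers are compared with the even ones, at distance \<open>p\<close>.
\<close>

lemma sum_abs_half_step_sum:
  "(\<Sum>a\<in>odds_upto (2 * p - 1). abs_half_step_sum (of_int (a * r) / (2 * of_int p))) = 4 * of_int p * ln 2"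
proof -
  obtain j where j: "p = 2 * j + 1" using p_odd by (elim oddE)
  then obtain k where "j = int k" using p by (intro that[of "nat j"]) simp
  hence k: "p = 2 * int k + 1" using j by simp
  have total: "((\<lambda>l. 1 / \<bar>of_int l\<bar> - 1 / \<bar>of_int (l + p)\<bar> :: real) has_sum 2 * ln 2) {l. odd l}"
    using alternating_harmonic_int_sum[of k] unfolding has_sum_odd_iff by (simp add: k add_ac)
  have "(\<Sum>a\<in>odds_upto (2 * p - 1). 1 / (2 * of_int p) * abs_half_step_sum (of_int (a * r) / (2 * of_int p))) = 2 * ln 2"
  proof (rule has_sum_odd_residue_classes[OF r p rp total])
    fix a assume a: "a \<in> odds_upto (2 * p - 1)"
    let ?\<beta> = "of_int (a * r) / (2 * of_int p) :: real"
    have "((\<lambda>n::int. 1 / (2 * of_int p) * (1 / \<bar>?\<beta> + of_int n\<bar> - 1 / \<bar>?\<beta> + 1/2 + of_int n\<bar>)) has_sum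
        1 / (2 * of_int p) * abs_half_step_sum ?\<beta>) UNIV"
      by (intro has_sum_cmult_right has_sum_abs_half_step_sum half_odd_residue_in_Ints_iff(1)[OF r p p_odd rp a])
    also have "(\<lambda>n::int. 1 / (2 * of_int p) * (1 / \<bar>?\<beta> + of_int n\<bar> - 1 / \<bar>?\<beta> + 1/2 + of_int n\<bar>)) =
      (\<lambda>n. 1 / \<bar>of_int (a * r + 2 * p * n)\<bar> - 1 / \<bar>of_int (a * r + 2 * p * n + p)\<bar>)"
    proof
      fix n
      have l: "of_int (a * r + 2 * p * n) = 2 * of_int p * (?\<beta> + of_int n)"
           "of_int (a * r + 2 * p * n + p) = 2 * of_int p * (?\<beta> + 1/2 + of_int n)"
        using p by (simp_all add: field_simps)
      have p_abs: "\<bar>2 * of_int p\<bar> = 2 * (of_int p :: real)" using p by simp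
      have "\<bar>of_int (a * r + 2 * p * n)\<bar> = 2 * of_int p * \<bar>?\<beta> + of_int n\<bar>"
        "\<bar>of_int (a * r + 2 * p * n + p)\<bar> = 2 * of_int p * \<bar>?\<beta> + 1/2 + of_int n\<bar>"
        unfolding l abs_mult[of "2 * of_int p"] p_abs by (rule refl)+
      thus "1 / (2 * of_int p) * (1 / \<bar>?\<beta> + of_int n\<bar> - 1 / \<bar>?\<beta> + 1/2 + of_int n\<bar>) =
          1 / \<bar>of_int (a * r + 2 * p * n)\<bar> - 1 / \<bar>of_int (a * r + 2 * p * n + p)\<bar>"
        by (simp only: right_diff_distrib times_divide_times_eq mult_1)
    qed
    finally show "((\<lambda>n. 1 / \<bar>of_int (a * r + 2 * p * n)\<bar> - 1 / \<bar>of_int (a * r + 2 * p * n + p)\<bar>) has_sum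
        1 / (2 * of_int p) * abs_half_step_sum ?\<beta>) UNIV" .
  qed
  hence "1 / (2 * of_int p) * (\<Sum>a\<in>odds_upto (2 * p - 1). abs_half_step_sum (of_int (a * r) / (2 * of_int p))) = 2 * ln 2"
    by (simp only: sum_distrib_left)
  thus ?thesis using p by (simp add: field_simps)
qed

text \<open>
  The double angle formulas give \<open>4 cos (2 x) / sin\<^sup>2 (2 x) = 1 / sin\<^sup>2 x - 1 / cos\<^sup>2 x\<close>, and the symmetry
  \<open>n \<mapsto> 2 p - n\<close> folds the odd residues onto those below \<open>p\<close>.
\<close>

lemma sum_cos_over_sin_square:
  "(\<Sum>n\<in>odds_upto (p - 2). cos (2 * half_angle r p n) / sin (2 * half_angle r p n) ^ 2) = (of_int p ^ 2 - 1) / 12"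
proof -
  \<comment> \<open>The sum of \<open>f\<close> over the residues other than \<open>p\<close> is \<open>(p\<^sup>2 - 1) - (p\<^sup>2 - 1) / 3\<close>.\<close>
  define f where "f = (\<lambda>n. 1 / sin (half_angle r p n) ^ 2 - 1 / cos (half_angle r p n) ^ 2)"
  have "(\<Sum>n\<in>odds_upto (2 * p - 1) - {p}. f n) = 2 *\<^sub>R (\<Sum>n\<in>odds_upto (p - 2). f n)"
    by (intro sum_odds_upto_fold[OF r p p_odd rp]) (simp only: f_def half_angle_reflect[OF r p p_odd rp] power2_minus)
  moreover have "(\<Sum>n\<in>odds_upto (2 * p - 1) - {p}. f n) = (of_int p ^ 2 - 1) - (of_int p ^ 2 - 1) / 3"
  proof -
    have "sin (half_angle r p p) ^ 2 = 1"
    proof -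
      obtain k where "r = 2 * k + 1" using r by (elim oddE)
      hence "2 * half_angle r p p = 2 * pi * of_int k + pi" using p by (simp add: field_simps)
      hence "cos (2 * half_angle r p p) = -1" by (simp only: cos_add) (simp add: cos_int_2pin)
      thus ?thesis unfolding cos_double_sin by simp
    qed
    hence "1 / sin (half_angle r p p) ^ 2 = 1" by (simp only: div_by_1)
    moreover have "(\<Sum>a\<in>odds_upto (2 * p - 1). 1 / sin (half_angle r p a) ^ 2) =
        1 / sin (half_angle r p p) ^ 2 + (\<Sum>a\<in>odds_upto (2 * p - 1) - {p}. 1 / sin (half_angle r p a) ^ 2)"
      by (intro sum.remove p_in_odds_upto[OF r p p_odd rp]) simp
    ultimately show ?thesis
      unfolding f_def sum_subtractf
      using sum_cosecant_square[OF r p p_odd rp] sum_secant_square[OF r p p_odd rp] by linarith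
  qed
  moreover have "(\<Sum>n\<in>odds_upto (p - 2). cos (2 * half_angle r p n) / sin (2 * half_angle r p n) ^ 2) =
      1/4 * (\<Sum>n\<in>odds_upto (p - 2). f n)"
    unfolding sum_distrib_left
  proof (rule sum.cong)
    fix n assume "n \<in> odds_upto (p - 2)"
    hence n: "n \<in> odds_upto (2 * p - 1)" "n \<noteq> p" using p by (auto simp: odds_upto_def)
    have "cos (2 * x) / sin (2 * x) ^ 2 = 1/4 * (1 / sin x ^ 2 - 1 / cos x ^ 2)"
      if "sin x \<noteq> 0" "cos x \<noteq> 0" for x :: real
      using that unfolding cos_double sin_double by (simp add: field_simps)
    from this[OF half_angle_nonzero(1)[OF r p p_odd rp n(1)] half_angle_nonzero(2)[OF r p p_odd rp n]]
    show "cos (2 * half_angle r p n) / sin (2 * half_angle r p n) ^ 2 = 1/4 * f n" by (simp only: f_def)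
  qed simp
  moreover have "x = y / 12" if "G = 2 *\<^sub>R F" "G = y - y / 3" "x = 1/4 * F" for x y F G :: real
    using that by simp
  ultimately show ?thesis by blast
qed

lemma T_sum_eq:
  "T_sum r p n = 8 * of_int p * sin (2 * half_angle r p n) * cos (pi * of_int n / (2 * of_int p)) ^ 3
     + 8 * cos (2 * half_angle r p n) * sin (pi * of_int n / (2 * of_int p)) ^ 3"
proof -
  define a b where "a = pi * of_int n / (2 * of_int p)" and "b = 2 * half_angle r p n"
  have "T_sum r p n = (of_int p + 1) * (sin (b - (2 * a + a)) + 3 * sin (b + a))
      + (of_int p - 1) * (sin (b + (2 * a + a)) + 3 * sin (b - a))"
  proof -
    have "T_sum r p n = (\<Sum>\<epsilon>\<in>{1, -1::real}. (of_int p + \<epsilon>) * (sin (b - \<epsilon> * (2 * a + a)) + 3 * sin (b + \<epsilon> * a)))"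
      unfolding T_sum_def
    proof (rule sum.cong)
      fix \<epsilon> :: real
      have "pi * (2 * of_int r - 3 * \<epsilon>) * of_int n / (2 * of_int p) = b - \<epsilon> * (2 * a + a)"
        "pi * (2 * of_int r + \<epsilon>) * of_int n / (2 * of_int p) = b + \<epsilon> * a"
        using p by (simp_all add: a_def b_def field_simps)
      thus "(of_int p + \<epsilon>) * (sin (pi * (2 * of_int r - 3 * \<epsilon>) * of_int n / (2 * of_int p))
          + 3 * sin (pi * (2 * of_int r + \<epsilon>) * of_int n / (2 * of_int p))) =
        (of_int p + \<epsilon>) * (sin (b - \<epsilon> * (2 * a + a)) + 3 * sin (b + \<epsilon> * a))" by (simp only:)
    qed simp
    thus ?thesis by simp
  qed
  moreover have s3: "sin (2 * a + a) = 3 * sin a - 4 * sin a ^ 3"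
  proof -
    have "sin (2 * a + a) = 2 * sin a * cos a ^ 2 + (1 - 2 * sin a ^ 2) * sin a"
      unfolding sin_add[of "2 * a" a] sin_double cos_double_sin by (simp add: power2_eq_square)
    thus ?thesis unfolding cos_squared_eq by (simp add: algebra_simps power2_eq_square power3_eq_cube)
  qed
  moreover have c3: "cos (2 * a + a) = 4 * cos a ^ 3 - 3 * cos a"
  proof -
    have "cos (2 * a + a) = (2 * cos a ^ 2 - 1) * cos a - 2 * sin a ^ 2 * cos a"
      unfolding cos_add[of "2 * a" a] sin_double cos_double_cos by (simp add: power2_eq_square)
    thus ?thesis unfolding sin_squared_eq by (simp add: algebra_simps power2_eq_square power3_eq_cube)
  qed
  ultimately have "T_sum r p n =
      (of_int p + 1) * ((sin b * (4 * cos a ^ 3 - 3 * cos a) - cos b * (3 * sin a - 4 * sin a ^ 3))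
         + 3 * (sin b * cos a + cos b * sin a))
      + (of_int p - 1) * ((sin b * (4 * cos a ^ 3 - 3 * cos a) + cos b * (3 * sin a - 4 * sin a ^ 3))
         + 3 * (sin b * cos a - cos b * sin a))"
    by (simp only: sin_add[of b] sin_diff[of b] s3 c3)
  thus ?thesis unfolding a_def[symmetric] b_def[symmetric] by (simp add: algebra_simps)
qed

lemma sigma2_eq_cot_cube_sum:
  "sigma2 r p = 2 / of_int p * (\<Sum>n\<in>odds_upto (p - 2).
      cot (pi * of_int n / (2 * of_int p)) ^ 3 / sin (pi * of_int n * (of_int r / of_int p)))"
proof -
  have b: "pi * of_int n * (of_int r / of_int p) = 2 * half_angle r p n" for n by simp
  have "(\<Sum>n\<in>odds_upto (p - 2). T_sum r p n / (sin (pi * of_int n / (2 * of_int p)) ^ 3 * sin (2 * half_angle r p n) ^ 2))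
     = (\<Sum>n\<in>odds_upto (p - 2). 8 * of_int p * (cot (pi * of_int n / (2 * of_int p)) ^ 3 / sin (2 * half_angle r p n))
          + 8 * (cos (2 * half_angle r p n) / sin (2 * half_angle r p n) ^ 2))"
  proof (rule sum.cong)
    fix n assume "n \<in> odds_upto (p - 2)"
    hence n: "n \<in> odds_upto (2 * p - 1)" "n \<noteq> p" and n0: "0 < n" "n < 2 * p" using p by (auto simp: odds_upto_def)
    have "0 < pi * of_int n / (2 * of_int p)" "pi * of_int n / (2 * of_int p) < pi"
      using n0 p by (simp_all add: field_simps flip: of_int_mult)
    hence "sin (pi * of_int n / (2 * of_int p)) \<noteq> 0" using sin_gt_zero by fastforce
    moreover have "sin (2 * half_angle r p n) \<noteq> 0"
      unfolding sin_double using half_angle_nonzero[OF r p p_odd rp n(1)] n(2) by simp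
    moreover have "(8 * P * S * c ^ 3 + 8 * C * s ^ 3) / (s ^ 3 * S ^ 2) = 8 * P * ((c / s) ^ 3 / S) + 8 * (C / S ^ 2)"
      if "s \<noteq> 0" "S \<noteq> 0" for P S c C s :: real
      using that by (simp add: field_simps power2_eq_square)
    ultimately show "T_sum r p n / (sin (pi * of_int n / (2 * of_int p)) ^ 3 * sin (2 * half_angle r p n) ^ 2) =
      8 * of_int p * (cot (pi * of_int n / (2 * of_int p)) ^ 3 / sin (2 * half_angle r p n))
          + 8 * (cos (2 * half_angle r p n) / sin (2 * half_angle r p n) ^ 2)"
      unfolding T_sum_eq cot_def by blast
  qed simp
  also have "\<dots> = 8 * of_int p * (\<Sum>n\<in>odds_upto (p - 2). cot (pi * of_int n / (2 * of_int p)) ^ 3 / sin (2 * half_angle r p n))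
      + 8 * ((of_int p ^ 2 - 1) / 12)"
    unfolding sum.distrib sum_distrib_left[symmetric] sum_cos_over_sin_square ..
  finally have X: "(\<Sum>n\<in>odds_upto (p - 2). T_sum r p n / (sin (pi * of_int n / (2 * of_int p)) ^ 3 * sin (2 * half_angle r p n) ^ 2))
    = 8 * of_int p * (\<Sum>n\<in>odds_upto (p - 2). cot (pi * of_int n / (2 * of_int p)) ^ 3 / sin (2 * half_angle r p n))
      + 8 * ((of_int p ^ 2 - 1) / 12)" .
  have "1 / (6 * P ^ 2) - 1 / 6 + 1 / (4 * P ^ 2) * (8 * P * Y + 8 * ((P ^ 2 - 1) / 12)) = 2 / P * Y"
    if "P \<noteq> 0" for P Y :: real
    using that by (simp add: field_simps power2_eq_square)
  thus ?thesis
    unfolding sigma2_def b X using p by simp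
qed

end

lemma second_derivative_cot:
  fixes x :: real
  assumes "sin x \<noteq> 0"
  shows "(deriv ^^ 2) cot x = 2 * cot x + 2 * cot x ^ 3"
proof -
  have "open (- (sin -` {0 :: real}))" by (intro open_Compl closed_vimage) (auto intro: continuous_intros)
  hence ev: "eventually (\<lambda>y. y \<in> - (sin -` {0 :: real})) (nhds x)" using assms by (intro eventually_nhds_in_open) auto
  have "eventually (\<lambda>y. deriv cot y = - inverse (sin y ^ 2)) (nhds x)"
    using ev by eventually_elim (auto intro!: DERIV_imp_deriv DERIV_cot)
  hence "deriv (deriv cot) x = deriv (\<lambda>y. - inverse (sin y ^ 2)) x" by (rule deriv_cong_ev) simp
  also have "\<dots> = 2 * cos x / sin x ^ 3"
    using assms by (intro DERIV_imp_deriv)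
      (auto intro!: derivative_eq_intros simp: power2_eq_square power3_eq_cube field_simps)
  also have "\<dots> = 2 * cos x * (sin x ^ 2 + cos x ^ 2) / sin x ^ 3" by simp
  also have "\<dots> = 2 * (cos x / sin x) + 2 * (cos x / sin x) ^ 3"
  proof -
    have "2 * c * (s ^ 2 + c ^ 2) / s ^ 3 = 2 * (c / s) + 2 * (c / s) ^ 3" if "s \<noteq> 0" for s c :: real
      using that by (simp add: field_simps power2_eq_square power3_eq_cube)
    thus ?thesis using assms by blast
  qed
  also have "cos x / sin x = cot x" by (simp add: cot_def)
  finally show ?thesis by (simp add: numeral_2_eq_2)
qed

section \<open>Eisenstein series as sums over odd integers\<close>

lemma has_sum_odd_powers:
  fixes w :: complex
  assumes "norm w < 1"
  shows "((\<lambda>m. w ^ m) has_sum (w / (1 - w ^ 2))) {n::nat. 1 \<le> n \<and> odd n}"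
proof -
  have w2: "norm (w ^ 2) < 1" using assms by (simp add: norm_power power_less_one_iff abs_square_less_1)
  have "((\<lambda>k. (w ^ 2) ^ k) has_sum (1 / (1 - w ^ 2))) UNIV"
    using w2 by (intro norm_summable_imp_has_sum geometric_sums)
      (auto simp: norm_power intro!: summable_geometric)
  from has_sum_cmult_right[OF this, of w]
  have "((\<lambda>k. w ^ (2 * k + 1)) has_sum (w / (1 - w ^ 2))) UNIV" by (simp add: power_mult)
  moreover have "bij_betw (\<lambda>k. 2 * k + 1) UNIV {n::nat. 1 \<le> n \<and> odd n}"
    by (rule bij_betwI[where g = "\<lambda>n. n div 2"]) auto
  ultimately show ?thesis using has_sum_reindex_bij_betw by blast
qed

lemma odd_powers_sum_eq_cosecant:
  fixes z :: complex
  assumes "Im z > 0"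
  defines "w \<equiv> exp (\<i> * z)"
  shows "w / (1 - w ^ 2) = \<i> / (2 * sin z)"
proof -
  have "norm w < 1" using assms by (simp add: w_def norm_exp_eq_Re)
  hence "norm (w ^ 2) < 1" by (simp add: norm_power power_less_one_iff abs_square_less_1)
  hence w2: "1 - w ^ 2 \<noteq> 0" by auto
  have w0: "w \<noteq> 0" by (simp add: w_def)
  have sin: "sin z = \<i> * (1 - w ^ 2) / (2 * w)"
    using w0 by (simp add: sin_exp_eq w_def exp_minus field_simps power2_eq_square)
  show ?thesis unfolding sin using w0 w2 by (simp add: field_simps)
qed

text \<open>
  Writing \<open>n = d m\<close> with odd \<open>d\<close> and \<open>m\<close> turns the series into a Lambert series, and the geometric series over the
  odd cofactors \<open>m\<close> is a cosecant.
\<close>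

lemma has_sum_E_odd:
  fixes T :: complex
  assumes T: "Im T > 0"
  shows "((\<lambda>d::nat. 1 / of_nat d ^ j * (\<i> / (2 * sin (of_real pi * of_nat d * T)))) has_sum
            E_odd (1 - int j) T) {n. 1 \<le> n \<and> odd n}"
proof -
  define N where "N = {n::nat. 1 \<le> n \<and> odd n}"
  define G where "G = (\<lambda>(d, m). 1 / of_nat d ^ j * exp (complex_of_real pi * \<i> * of_nat (d * m) * T))"
  define q where "q = exp (- (pi * Im T))"
  have q: "0 < q" "q < 1" using T by (simp_all add: q_def)
  have norm_exp: "norm (exp (complex_of_real pi * \<i> * of_nat n * T)) = q ^ n" for n
    by (simp add: norm_exp_eq_Re q_def exp_of_nat_mult[symmetric] mult_ac)
  have "G summable_on N \<times> N"
  proof (rule abs_summable_summable, rule Infinite_Sum.abs_summable_on_comparison_test')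
    have geo: "(\<lambda>n. q ^ n) summable_on N"
      by (rule summable_on_subset[of _ UNIV])
         (use q in \<open>auto intro!: norm_summable_imp_summable_on summable_geometric\<close>)
    show "(\<lambda>(d, m). q ^ d * (inverse q * q ^ m)) summable_on N \<times> N"
      using q by (intro abs_summable_on_product summable_on_cmult_right geo) auto
    fix x assume "x \<in> N \<times> N"
    then obtain d m where x: "x = (d, m)" "d \<ge> 1" "m \<ge> 1" by (auto simp: N_def)
    have "real d ^ j \<ge> 1" using x by (intro one_le_power) auto
    hence "norm (G x) \<le> 1 * q ^ (d * m)"
      unfolding x G_def prod.case norm_mult norm_exp using q
      by (intro mult_right_mono) (auto simp: norm_divide norm_power divide_le_eq_1)
    \<comment> \<open>\<open>d m - (d + m - 1) = (d - 1) (m - 1)\<close>; the bound separates the two variables.\<close>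
    also have "q ^ (d * m) \<le> q ^ (d + m - 1)"
    proof (rule power_decreasing)
      obtain d' m' where "d = Suc d'" "m = Suc m'" using x by (metis Suc_le_D One_nat_def)
      thus "d + m - 1 \<le> d * m" by simp
    qed (use q in auto)
    also have "\<dots> = q ^ d * (inverse q * q ^ m)"
    proof -
      obtain m' where "m = Suc m'" using x by (metis Suc_le_D One_nat_def)
      thus ?thesis using q by (simp add: power_add)
    qed
    finally show "norm (G x) \<le> (case x of (d, m) \<Rightarrow> q ^ d * (inverse q * q ^ m))" by (simp add: x)
  qed
  then obtain S where S: "(G has_sum S) (N \<times> N)" by (auto simp: summable_on_def)
  have rows: "((\<lambda>d. 1 / of_nat d ^ j * (\<i> / (2 * sin (of_real pi * of_nat d * T)))) has_sum S) N"
  proof (rule has_sum_SigmaD[OF S])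
    fix d assume d: "d \<in> N"
    define z where "z = of_real pi * of_nat d * T"
    have imz: "Im z > 0" using d T by (simp add: z_def N_def)
    have "norm (exp (\<i> * z)) < 1" using imz by (simp add: norm_exp_eq_Re)
    from has_sum_cmult_right[OF has_sum_odd_powers[OF this], of "1 / of_nat d ^ j"]
    have "((\<lambda>m. 1 / of_nat d ^ j * exp (\<i> * z) ^ m) has_sum 1 / of_nat d ^ j * (\<i> / (2 * sin z))) N"
      unfolding odd_powers_sum_eq_cosecant[OF imz] N_def .
    moreover have "G (d, m) = 1 / of_nat d ^ j * exp (\<i> * z) ^ m" for m
      by (simp add: G_def z_def exp_of_nat_mult[symmetric] mult_ac)
    ultimately show "((\<lambda>m. G (d, m)) has_sum 1 / of_nat d ^ j * (\<i> / (2 * sin (of_real pi * of_nat d * T)))) N"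
      by (simp add: z_def)
  qed
  define H where "H = (\<lambda>(n, d). 1 / of_nat d ^ j * exp (complex_of_real pi * \<i> * of_nat n * T))"
  have "bij_betw (\<lambda>(d, m). (d * m, d)) (N \<times> N) (Sigma N (\<lambda>n. {d. 0 < d \<and> d dvd n}))"
  proof (rule bij_betwI[where g = "\<lambda>(n, d). (d, n div d)"])
    show "(\<lambda>(n, d). (d, n div d)) \<in> Sigma N (\<lambda>n. {d. 0 < d \<and> d dvd n}) \<rightarrow> N \<times> N"
    proof (rule Pi_I)
      fix y :: "nat \<times> nat" assume "y \<in> Sigma N (\<lambda>n. {d. 0 < d \<and> d dvd n})"
      then obtain d m where "y = (d * m, d)" "d * m \<in> N" "0 < d" by (auto elim!: dvdE)
      thus "(case y of (n, d) \<Rightarrow> (d, n div d)) \<in> N \<times> N" by (auto simp: N_def)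
    qed
  qed (auto simp: N_def)
  from has_sum_reindex_bij_betw[OF this, of H S]
  have "(H has_sum S) (Sigma N (\<lambda>n. {d. 0 < d \<and> d dvd n}))"
    using S by (simp add: H_def G_def case_prod_unfold)
  hence "((\<lambda>n. complex_of_real (divisor_power_sum (1 - int j - 1) n) * exp (complex_of_real pi * \<i> * of_nat n * T)) has_sum S) N"
  proof (rule has_sum_SigmaD)
    fix n assume n: "n \<in> N"
    have fin: "finite {d. 0 < d \<and> d dvd n}" using n by (intro finite_subset[OF _ finite_divisors_nat[of n]]) (auto simp: N_def)
    have "(\<Sum>d | 0 < d \<and> d dvd n. H (n, d)) =
       complex_of_real (divisor_power_sum (1 - int j - 1) n) * exp (complex_of_real pi * \<i> * of_nat n * T)"
      unfolding divisor_power_sum_def of_real_sum sum_distrib_right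
      by (intro sum.cong) (simp_all add: H_def power_int_minus power_int_of_nat divide_inverse)
    thus "((\<lambda>d. H (n, d)) has_sum complex_of_real (divisor_power_sum (1 - int j - 1) n)
       * exp (complex_of_real pi * \<i> * of_nat n * T)) {d. 0 < d \<and> d dvd n}"
      using fin by (intro has_sum_finiteI) simp_all
  qed
  hence "E_odd (1 - int j) T = S" unfolding E_odd_def N_def by (rule infsumI)
  thus ?thesis using rows by (simp add: N_def)
qed

text \<open>
  For odd \<open>j\<close> the summand is even in \<open>d\<close>, and each sign of \<open>d\<close> contributes half of the sum.
\<close>

lemma has_sum_E_odd_int:
  fixes T :: complex
  assumes T: "Im T > 0" and j: "odd j"
  shows "((\<lambda>d::int. 1 / (of_int d ^ j * sin (of_real pi * of_int d * T))) has_sum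
            (- 4 * \<i>) * E_odd (1 - int j) T) {d. odd d}"
proof -
  define f where "f = (\<lambda>d::int. 1 / (of_int d ^ j * sin (of_real pi * of_int d * T)))"
  define N where "N = {n::nat. 1 \<le> n \<and> odd n}"
  have even: "f (- d) = f d" for d using j by (simp add: f_def)
  have "(\<lambda>d. (- 2 * \<i>) * (1 / of_nat d ^ j * (\<i> / (2 * sin (of_real pi * of_nat d * T))))) = (\<lambda>d. f (int d))"
    by (simp add: f_def fun_eq_iff)
  hence half: "((\<lambda>d. f (int d)) has_sum (- 2 * \<i>) * E_odd (1 - int j) T) N"
    using has_sum_cmult_right[OF has_sum_E_odd[OF T, of j], of "- 2 * \<i>"] unfolding N_def by simp
  have "bij_betw int N {d. odd d \<and> d > 0}"
    by (rule bij_betwI[where g = nat]) (auto simp: N_def even_nat_iff)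
  from has_sum_reindex_bij_betw[OF this, of f] half
  have pos: "(f has_sum (- 2 * \<i>) * E_odd (1 - int j) T) {d. odd d \<and> d > 0}" by simp
  have "bij_betw (\<lambda>d. - int d) N {d. odd d \<and> d < 0}"
    by (rule bij_betwI[where g = "\<lambda>d. nat (- d)"]) (auto simp: N_def even_nat_iff)
  from has_sum_reindex_bij_betw[OF this, of f] half
  have neg: "(f has_sum (- 2 * \<i>) * E_odd (1 - int j) T) {d. odd d \<and> d < 0}" by (simp add: even)
  have "{d::int. odd d} = {d. odd d \<and> d > 0} \<union> {d. odd d \<and> d < 0}" 
  proof (rule set_eqI)
    fix d :: int
    have "d > 0 \<or> d = 0 \<or> d < 0" by linarith
    thus "d \<in> {d. odd d} \<longleftrightarrow> d \<in> {d. odd d \<and> d > 0} \<union> {d. odd d \<and> d < 0}" by auto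
  qed
  moreover have "(f has_sum ((- 2 * \<i>) * E_odd (1 - int j) T + (- 2 * \<i>) * E_odd (1 - int j) T))
      ({d. odd d \<and> d > 0} \<union> {d. odd d \<and> d < 0})"
    by (intro has_sum_Un_disjoint pos neg) auto
  ultimately show ?thesis unfolding f_def by (simp add: mult_ac)
qed

section \<open>Nontangential limits\<close>

lemma reg_cosecant_at_0_eq:
  assumes \<beta>: "\<beta> \<notin> \<int>" and \<beta>': "\<beta> + 1/2 \<notin> \<int>"
  shows "reg_cosecant_at_0 \<beta> = 2 * of_real pi / of_real (sin (2 * pi * \<beta>))"
proof -
  have "2 * complex_of_real \<beta> \<notin> \<int>"
  proof
    assume "2 * complex_of_real \<beta> \<in> \<int>"
    then obtain k where "complex_of_real (2 * \<beta>) = of_real (of_int k)" by (auto elim!: Ints_cases)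
    hence k: "2 * \<beta> = of_int k" by (simp only: of_real_eq_iff)
    show False
    proof (cases "even k")
      case True
      then obtain i where "k = 2 * i" by (elim evenE)
      hence "\<beta> = of_int i" using k by simp
      thus False using \<beta> by simp
    next
      case False
      then obtain i where "k = 2 * i + 1" by (elim oddE)
      hence "\<beta> + 1/2 = of_int (i + 1)" using k by simp
      thus False using \<beta>' Ints_of_int by metis
    qed
  qed
  from cosecant_series[OF this]
  have "((\<lambda>n::int. pole_term 0 (\<beta> + of_int n) - pole_term 0 (\<beta> + 1/2 + of_int n)) has_sum
      (2 * of_real pi / sin (2 * of_real pi * of_real \<beta>))) UNIV"
    using add_of_int_nonzero[OF \<beta>] add_of_int_nonzero[OF \<beta>'] by (simp add: pole_term_def add_ac)
  from has_sum_unique[OF has_sum_reg_cosecant_at_0[OF \<beta>] this]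
  have "reg_cosecant_at_0 \<beta> = 2 * of_real pi / sin (2 * of_real pi * of_real \<beta>)" .
  also have "sin (2 * of_real pi * complex_of_real \<beta>) = of_real (sin (2 * pi * \<beta>))"
    by (simp flip: sin_of_real)
  finally show ?thesis .
qed

context
  fixes r p :: int
  assumes r: "odd r" and p: "p > 0" and p_odd: "odd p" and rp: "coprime r p"
begin

private abbreviation "\<alpha> a \<equiv> of_int a / (2 * of_int p) :: real"
private abbreviation "\<beta> a \<equiv> of_int (a * r) / (2 * of_int p) :: real"

lemma odd_residue_not_Int: "a \<in> odds_upto (2 * p - 1) \<Longrightarrow> \<alpha> a \<notin> \<int>"
  using half_odd_residue_in_Ints_iff(1)[of 1 p a] p p_odd by simp

lemma cosecant_term_residue_class:
  assumes j: "j > 0"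
  shows "1 / ((2 * of_int p) ^ j * (2 * of_real pi)) * cosecant_term j (\<alpha> a) (\<beta> a) (of_int p * \<tau>) n
    = 1 / (of_int (a + 2 * p * n) ^ j * sin (of_real pi * of_int (a + 2 * p * n) * (\<tau> + of_real (of_int r / of_int p))))"
proof -
  define u where "u = complex_of_real (\<alpha> a + of_int n)"
  define v where "v = 2 * of_real pi * (u * (of_int p * \<tau>) + of_real (\<beta> a))"
  have p0: "complex_of_int p \<noteq> 0" using p by simp
  have u: "of_int (a + 2 * p * n) = 2 * of_int p * u"
    using p0 by (simp add: u_def field_simps)
  have "of_real pi * of_int (a + 2 * p * n) * (\<tau> + of_real (of_int r / of_int p))
      = v + 2 * of_real pi * of_int (n * r)"
    using p0 by (simp add: u_def v_def field_simps)
  moreover have "sin (v + 2 * of_real pi * of_int (n * r)) = sin v"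
  proof -
    have "sin (2 * of_real pi * of_int (n * r)) = complex_of_real (sin (2 * pi * of_int (n * r)))"
      "cos (2 * of_real pi * of_int (n * r)) = complex_of_real (cos (2 * pi * of_int (n * r)))"
      by (simp_all flip: sin_of_real cos_of_real)
    thus ?thesis by (simp only: sin_add sin_int_2pin cos_int_2pin) simp
  qed
  ultimately have "1 / (of_int (a + 2 * p * n) ^ j * sin (of_real pi * of_int (a + 2 * p * n) * (\<tau> + of_real (of_int r / of_int p))))
    = 1 / ((2 * of_int p * u) ^ j * sin v)" by (simp only: u)
  moreover have "cosecant_term j (\<alpha> a) (\<beta> a) (of_int p * \<tau>) n = 1 / u ^ j * (2 * of_real pi / sin v)"
    by (simp only: cosecant_term_def u_def v_def)
  ultimately show ?thesis by (simp add: power_mult_distrib field_simps)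
qed

text \<open>
  This collects the asymptotics of the finitely many residue classes, at \<open>s = p \<tau>\<close>. The coefficient \<open>P a\<close>
  belongs to the pole of the class at \<open>s = 0\<close>, and \<open>l a\<close> is its limit after removal of that pole.
\<close>

lemma E_odd_asymptotics_from_classes:
  fixes j :: nat and P l :: "int \<Rightarrow> complex"
  assumes j: "odd j" and c: "c > 0"
    and classes: "\<And>a. a \<in> odds_upto (2 * p - 1) \<Longrightarrow> \<exists>C. \<forall>s\<in>upper_cone c. \<exists>Q.
        (cosecant_term j (\<alpha> a) (\<beta> a) s has_sum Q) UNIV \<and> norm (Q + P a / s - l a) \<le> C * norm s"
  shows "((\<lambda>\<tau>. (2 * of_int p) ^ j * (2 * of_real pi) * (- 4 * \<i>) * E_odd (1 - int j) (\<tau> + of_real (of_int r / of_int p))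
           + (\<Sum>a\<in>odds_upto (2 * p - 1). P a) / (of_int p * \<tau>))
      \<longlongrightarrow> (\<Sum>a\<in>odds_upto (2 * p - 1). l a)) (at 0 within upper_cone c)"
proof -
  let ?A = "odds_upto (2 * p - 1)"
  let ?B = "complex_of_int (2 * p) ^ j * (2 * of_real pi)"
  have j0: "j > 0" using j by (rule odd_pos)
  have B0: "?B \<noteq> 0" using p by simp
  obtain C where C: "\<And>a s. a \<in> ?A \<Longrightarrow> s \<in> upper_cone c \<Longrightarrow> \<exists>Q.
        (cosecant_term j (\<alpha> a) (\<beta> a) s has_sum Q) UNIV \<and> norm (Q + P a / s - l a) \<le> C a * norm s"
    using classes by metis
  define D where "D = (\<Sum>a\<in>?A. C a) * of_int p"
  have bound: "norm (?B * (- 4 * \<i>) * E_odd (1 - int j) (\<tau> + of_real (of_int r / of_int p))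
           + (\<Sum>a\<in>?A. P a) / (of_int p * \<tau>) - (\<Sum>a\<in>?A. l a)) \<le> D * norm \<tau>" if \<tau>: "\<tau> \<in> upper_cone c" for \<tau>
  proof -
    let ?T = "\<tau> + of_real (of_int r / of_int p)" and ?s = "of_int p * \<tau>"
    have "norm \<tau> > 0" "c * norm \<tau> \<le> Im \<tau>" using \<tau> by (auto simp: upper_cone_def)
    hence "Im \<tau> > 0" using c by (auto intro: less_le_trans[of 0 "c * norm \<tau>"])
    hence T: "Im ?T > 0" by simp
    have s: "?s \<in> upper_cone c" using \<tau> p by (simp add: upper_cone_def norm_mult mult.left_commute)
    have "\<forall>a\<in>?A. \<exists>q. (cosecant_term j (\<alpha> a) (\<beta> a) ?s has_sum q) UNIV \<and> norm (q + P a / ?s - l a) \<le> C a * norm ?s"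
      using C[OF _ s] by blast
    then obtain Q where Q: "\<And>a. a \<in> ?A \<Longrightarrow> (cosecant_term j (\<alpha> a) (\<beta> a) ?s has_sum Q a) UNIV"
      and Q': "\<And>a. a \<in> ?A \<Longrightarrow> norm (Q a + P a / ?s - l a) \<le> C a * norm ?s" by metis
    have "(\<Sum>a\<in>?A. 1 / ?B * Q a) = - 4 * \<i> * E_odd (1 - int j) ?T"
    proof (rule has_sum_odd_residue_classes[of 1 p, OF _ p _ has_sum_E_odd_int[OF T j]])
      fix a assume "a \<in> ?A"
      from has_sum_cmult_right[OF Q[OF this], of "1 / ?B"]
      show "((\<lambda>n. 1 / (of_int (a * 1 + 2 * p * n) ^ j * sin (of_real pi * of_int (a * 1 + 2 * p * n) * ?T))) has_sum 1 / ?B * Q a) UNIV"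
        using cosecant_term_residue_class[OF j0, of a \<tau>] by (simp only: mult_1_right of_int_mult of_int_numeral)
    qed auto
    hence "1 / ?B * (\<Sum>a\<in>?A. Q a) = - 4 * \<i> * E_odd (1 - int j) ?T" by (simp only: sum_distrib_left)
    moreover have "b * y = S" if "1 / b * S = y" "b \<noteq> 0" for b y S :: complex using that by auto
    ultimately have "?B * (- 4 * \<i> * E_odd (1 - int j) ?T) = (\<Sum>a\<in>?A. Q a)" using B0 by blast
    hence "?B * (- 4 * \<i>) * E_odd (1 - int j) ?T + (\<Sum>a\<in>?A. P a) / ?s - (\<Sum>a\<in>?A. l a) = (\<Sum>a\<in>?A. Q a + P a / ?s - l a)"
      by (simp add: sum.distrib sum_subtractf sum_divide_distrib mult.assoc)
    also have "norm \<dots> \<le> (\<Sum>a\<in>?A. C a * norm ?s)" by (intro sum_norm_le Q')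
    also have "\<dots> = D * norm \<tau>" using p by (simp add: D_def norm_mult sum_distrib_right[symmetric] mult.assoc)
    finally show ?thesis .
  qed
  have "((\<lambda>\<tau>. ?B * (- 4 * \<i>) * E_odd (1 - int j) (\<tau> + of_real (of_int r / of_int p))
           + (\<Sum>a\<in>?A. P a) / (of_int p * \<tau>) - (\<Sum>a\<in>?A. l a)) \<longlongrightarrow> 0) (at 0 within upper_cone c)"
  proof (rule Lim_null_comparison)
    show "eventually (\<lambda>\<tau>. norm (?B * (- 4 * \<i>) * E_odd (1 - int j) (\<tau> + of_real (of_int r / of_int p))
           + (\<Sum>a\<in>?A. P a) / (of_int p * \<tau>) - (\<Sum>a\<in>?A. l a)) \<le> D * norm \<tau>) (at 0 within upper_cone c)"
      using bound by (auto simp: eventually_at_filter)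
    show "((\<lambda>\<tau>. D * norm \<tau>) \<longlongrightarrow> 0) (at 0 within upper_cone c)"
      by (auto intro!: tendsto_eq_intros)
  qed
  thus ?thesis by (subst (asm) LIM_zero_iff) simp
qed

lemma residue_p: "\<alpha> p = 1/2" using p by simp

lemma sum_odd_residue_cosecant:
  fixes g :: "real \<Rightarrow> real"
  assumes g: "\<And>x. g (pi - x) = - g x"
  shows "(\<Sum>a\<in>odds_upto (2 * p - 1) - {p}. g (pi * of_int a / (2 * of_int p)) / sin (pi * of_int a * (of_int r / of_int p)))
    = 2 * (\<Sum>a\<in>odds_upto (p - 2). g (pi * of_int a / (2 * of_int p)) / sin (pi * of_int a * (of_int r / of_int p)))"
proof -
  have sin: "sin (pi * of_int a * (of_int r / of_int p)) = 2 * sin (pi * \<beta> a) * cos (pi * \<beta> a)" for a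
  proof -
    have "pi * of_int a * (of_int r / of_int p) = 2 * (pi * \<beta> a)" by simp
    thus ?thesis by (simp only: sin_double mult.assoc)
  qed
  have "g (pi * of_int (2 * p - a) / (2 * of_int p)) / sin (pi * of_int (2 * p - a) * (of_int r / of_int p))
      = g (pi * of_int a / (2 * of_int p)) / sin (pi * of_int a * (of_int r / of_int p))" for a
  proof -
    have "pi * of_int (2 * p - a) / (2 * of_int p) = pi - pi * of_int a / (2 * of_int p)"
      using p by (simp add: field_simps)
    thus ?thesis unfolding sin half_angle_reflect[OF r p p_odd rp] by (simp only: g)
  qed
  from sum_odds_upto_fold[OF r p p_odd rp, of "\<lambda>a. g (pi * of_int a / (2 * of_int p)) / sin (pi * of_int a * (of_int r / of_int p))", OF this]
  show ?thesis by simp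
qed

lemma pole_defect_residue:
  "a \<in> odds_upto (2 * p - 1) \<Longrightarrow> pole_defect (\<beta> a) = (if a = p then 1 else 0)"
  using half_odd_residue_in_Ints_iff(2)[OF r p p_odd rp] by (simp add: pole_defect_def)

lemma reg_cosecant_residue:
  assumes "a \<in> odds_upto (2 * p - 1)" "a \<noteq> p"
  shows "reg_cosecant_at_0 (\<beta> a) = of_real (2 * pi / sin (pi * of_int a * (of_int r / of_int p)))"
proof -
  have angle: "2 * pi * \<beta> a = pi * of_int a * (of_int r / of_int p)" by simp
  have "reg_cosecant_at_0 (\<beta> a) = 2 * of_real pi / of_real (sin (2 * pi * \<beta> a))"
    using assms(2) half_odd_residue_in_Ints_iff[OF r p p_odd rp assms(1)] by (intro reg_cosecant_at_0_eq) blast+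
  thus ?thesis unfolding angle by simp
qed

lemma sum_pole_defects:
  assumes "S p = (v :: complex)"
  shows "(\<Sum>a\<in>odds_upto (2 * p - 1). pole_defect (\<beta> a) * S a) = v"
proof -
  have "(\<Sum>a\<in>odds_upto (2 * p - 1). pole_defect (\<beta> a) * S a) = (\<Sum>a\<in>odds_upto (2 * p - 1). if a = p then S a else 0)"
  proof (rule sum.cong)
    fix a assume a: "a \<in> odds_upto (2 * p - 1)"
    show "pole_defect (\<beta> a) * S a = (if a = p then S a else 0)" by (simp only: pole_defect_residue[OF a]) simp
  qed simp
  thus ?thesis using p_in_odds_upto[OF r p p_odd rp] assms by simp
qed

lemma inverse_power_series_residue:
  assumes a: "a \<in> odds_upto (2 * p - 1)"
  defines "x \<equiv> pi * of_int a / (2 * of_int p)"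
  shows "((\<lambda>m::int. 1 / complex_of_real (\<alpha> a + of_int m) ^ 2) has_sum of_real (pi ^ 2 / sin x ^ 2)) UNIV"
    and "((\<lambda>m::int. 1 / complex_of_real (\<alpha> a + of_int m) ^ 3) has_sum of_real (pi ^ 3 * cos x / sin x ^ 3)) UNIV"
    and "((\<lambda>m::int. 1 / complex_of_real (\<alpha> a + of_int m) ^ 4) has_sum
            of_real (pi ^ 4 * (sin x ^ 2 + 3 * cos x ^ 2) / (3 * sin x ^ 4))) UNIV"
proof -
  have z: "complex_of_real (\<alpha> a) \<notin> \<int>"
    using odd_residue_not_Int[OF a] by (metis Ints_cases Ints_of_int of_real_eq_iff of_real_of_int_eq)
  have x: "sin (of_real pi * of_real (\<alpha> a)) = complex_of_real (sin x)" "cos (of_real pi * of_real (\<alpha> a)) = complex_of_real (cos x)"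
    unfolding x_def by (simp_all flip: sin_of_real cos_of_real)
  show "((\<lambda>m::int. 1 / complex_of_real (\<alpha> a + of_int m) ^ 2) has_sum of_real (pi ^ 2 / sin x ^ 2)) UNIV"
    using inverse_square_series[OF z] unfolding x by simp
  show "((\<lambda>m::int. 1 / complex_of_real (\<alpha> a + of_int m) ^ 3) has_sum of_real (pi ^ 3 * cos x / sin x ^ 3)) UNIV"
    using inverse_cube_series[OF z] unfolding x by simp
  show "((\<lambda>m::int. 1 / complex_of_real (\<alpha> a + of_int m) ^ 4) has_sum
            of_real (pi ^ 4 * (sin x ^ 2 + 3 * cos x ^ 2) / (3 * sin x ^ 4))) UNIV"
    using inverse_fourth_series[OF z] unfolding x by simp
qed

lemma sin_odd_residue_nonzero: "a \<in> odds_upto (2 * p - 1) \<Longrightarrow> sin (pi * of_int a / (2 * of_int p)) \<noteq> (0::real)"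
  using half_angle_nonzero(1)[of 1 p a] p p_odd by simp

lemma odds_upto_subset: "a \<in> odds_upto (p - 2) \<Longrightarrow> a \<in> odds_upto (2 * p - 1)"
  using p by (simp add: odds_upto_def)

text \<open>
  The class \<open>a = p\<close> enters the limit only through \<open>abs_half_step_sum\<close>, because \<open>cot (\<pi>/2) = 0\<close>.
\<close>

lemma E_odd_0_asymptotics:
  assumes c: "c > 0"
  shows "((\<lambda>\<tau>. (2 * of_int p) * (2 * of_real pi) * (- 4 * \<i>) * E_odd 0 (\<tau> + of_real (of_int r / of_int p))
           + of_real (pi ^ 2) / (of_int p * \<tau>))
      \<longlongrightarrow> of_real (4 * pi ^ 2 * of_int p * S_odd 0 r p) - \<i> * of_real (4 * pi * of_int p * ln 2)) (at 0 within upper_cone c)"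
proof -
  let ?A = "odds_upto (2 * p - 1)"
  define x where "x = (\<lambda>a. pi * of_int a / (2 * of_int p) :: real)"
  define y where "y = (\<lambda>a. pi * of_int a * (of_int r / of_int p) :: real)"
  define P where "P = (\<lambda>a. pole_defect (\<beta> a) * of_real (pi ^ 2 / sin (x a) ^ 2))"
  define l where "l = (\<lambda>a. of_real pi * cot (of_real (pi * \<alpha> a)) * reg_cosecant_at_0 (\<beta> a)
      - \<i> * of_real pi * of_real (abs_half_step_sum (\<beta> a)))"
  have "((\<lambda>\<tau>. (2 * of_int p) ^ 1 * (2 * of_real pi) * (- 4 * \<i>) * E_odd (1 - int 1) (\<tau> + of_real (of_int r / of_int p))
           + (\<Sum>a\<in>?A. P a) / (of_int p * \<tau>)) \<longlongrightarrow> (\<Sum>a\<in>?A. l a)) (at 0 within upper_cone c)"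
    unfolding P_def l_def x_def
    by (intro E_odd_asymptotics_from_classes c linear_cosecant_sum odd_residue_not_Int
        half_odd_residue_in_Ints_iff(1)[OF r p p_odd rp] inverse_power_series_residue) auto
  moreover have "(\<Sum>a\<in>?A. P a) = of_real (pi ^ 2)"
    unfolding P_def using p by (intro sum_pole_defects) (simp add: x_def)
  moreover have "(\<Sum>a\<in>?A. l a) = of_real (4 * pi ^ 2 * of_int p * S_odd 0 r p) - \<i> * of_real (4 * pi * of_int p * ln 2)"
  proof -
    have "(\<Sum>a\<in>?A. of_real pi * cot (of_real (pi * \<alpha> a)) * reg_cosecant_at_0 (\<beta> a)) =
       (\<Sum>a\<in>?A - {p}. of_real pi * cot (of_real (pi * \<alpha> a)) * reg_cosecant_at_0 (\<beta> a))"
    proof (rule sum.mono_neutral_right)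
      have "cot (complex_of_real (pi * \<alpha> p)) = of_real (cot (pi / 2))"
        unfolding residue_p cot_of_real by simp
      hence zero: "of_real pi * cot (of_real (pi * \<alpha> p)) * reg_cosecant_at_0 (\<beta> p) = 0"
        by (simp only:) (simp add: cot_def)
      show "\<forall>a\<in>?A - (?A - {p}). of_real pi * cot (of_real (pi * \<alpha> a)) * reg_cosecant_at_0 (\<beta> a) = 0"
      proof
        fix a assume "a \<in> ?A - (?A - {p})"
        hence "a = p" by auto
        thus "of_real pi * cot (of_real (pi * \<alpha> a)) * reg_cosecant_at_0 (\<beta> a) = 0" by (simp only: zero)
      qed
    qed auto
    also have "\<dots> = (\<Sum>a\<in>?A - {p}. of_real (2 * pi ^ 2 * (cot (x a) / sin (y a))))"
    proof (rule sum.cong)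
      fix a assume a: "a \<in> ?A - {p}"
      have "cot (complex_of_real (pi * \<alpha> a)) = of_real (cot (x a))" by (simp add: x_def cot_of_real)
      moreover have "reg_cosecant_at_0 (\<beta> a) = of_real (2 * pi / sin (y a))"
        unfolding y_def using a by (intro reg_cosecant_residue) auto
      ultimately show "of_real pi * cot (of_real (pi * \<alpha> a)) * reg_cosecant_at_0 (\<beta> a) = of_real (2 * pi ^ 2 * (cot (x a) / sin (y a)))"
        by (simp add: power2_eq_square)
    qed simp
    also have "\<dots> = of_real (2 * pi ^ 2 * (\<Sum>a\<in>?A - {p}. cot (x a) / sin (y a)))"
      by (simp add: sum_distrib_left)
    also have "(\<Sum>a\<in>?A - {p}. cot (x a) / sin (y a)) = 2 * (\<Sum>a\<in>odds_upto (p - 2). cot (x a) / sin (y a))"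
      unfolding x_def y_def by (rule sum_odd_residue_cosecant) (simp add: cot_def)
    also have "(\<Sum>a\<in>odds_upto (p - 2). cot (x a) / sin (y a)) = of_int p * S_odd 0 r p"
      using p by (simp add: S_odd_def x_def y_def)
    finally have "(\<Sum>a\<in>?A. of_real pi * cot (of_real (pi * \<alpha> a)) * reg_cosecant_at_0 (\<beta> a)) =
        complex_of_real (4 * pi ^ 2 * of_int p * S_odd 0 r p)" by (simp add: mult_ac)
    moreover have "(\<Sum>a\<in>?A. \<i> * of_real pi * of_real (abs_half_step_sum (\<beta> a))) =
        \<i> * of_real pi * of_real (\<Sum>a\<in>?A. abs_half_step_sum (\<beta> a))"
      by (simp add: sum_distrib_left)
    ultimately show ?thesis
      unfolding l_def sum_subtractf sum_abs_half_step_sum[OF r p p_odd rp] by (simp add: mult_ac)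
  qed
  ultimately show ?thesis by simp
qed

lemma S_odd_2_eq:
  "S_odd 2 r p = 1 / of_int p ^ 3 * (\<Sum>n\<in>odds_upto (p - 2).
     (2 * cot (pi * of_int n / (2 * of_int p)) + 2 * cot (pi * of_int n / (2 * of_int p)) ^ 3) / sin (pi * of_int n * (of_int r / of_int p)))"
proof -
  have "(\<Sum>n\<in>odds_upto (p - 2). (deriv ^^ 2) cot (pi * of_int n / (2 * of_int p)) / sin (pi * of_int n * (of_int r / of_int p))) =
    (\<Sum>n\<in>odds_upto (p - 2). (2 * cot (pi * of_int n / (2 * of_int p)) + 2 * cot (pi * of_int n / (2 * of_int p)) ^ 3) / sin (pi * of_int n * (of_int r / of_int p)))"
    by (intro sum.cong refl arg_cong2[of _ _ _ _ "(/)"] second_derivative_cot sin_odd_residue_nonzero odds_upto_subset)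
  thus ?thesis by (simp only: S_odd_def) simp
qed

text \<open>
  The class \<open>a = p\<close> contributes a pole and nothing to the limit, because the sum of the inverse cubes of
  \<open>m + 1/2\<close> vanishes.
\<close>

lemma E_odd_minus_2_asymptotics:
  assumes c: "c > 0"
  shows "((\<lambda>\<tau>. (2 * of_int p) ^ 3 * (2 * of_real pi) * (- 4 * \<i>) * E_odd (- 2) (\<tau> + of_real (of_int r / of_int p))
           + of_real (pi ^ 4 / 3) / (of_int p * \<tau>))
      \<longlongrightarrow> of_real (2 * pi ^ 4 * of_int p ^ 3 * S_odd 2 r p)) (at 0 within upper_cone c)"
proof -
  let ?A = "odds_upto (2 * p - 1)"
  define x where "x = (\<lambda>a. pi * of_int a / (2 * of_int p) :: real)"
  define y where "y = (\<lambda>a. pi * of_int a * (of_int r / of_int p) :: real)"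
  define P where "P = (\<lambda>a. pole_defect (\<beta> a) * of_real (pi ^ 4 * (sin (x a) ^ 2 + 3 * cos (x a) ^ 2) / (3 * sin (x a) ^ 4)))"
  define l where "l = (\<lambda>a. reg_cosecant_at_0 (\<beta> a) * of_real (pi ^ 3 * cos (x a) / sin (x a) ^ 3))"
  have "((\<lambda>\<tau>. (2 * of_int p) ^ 3 * (2 * of_real pi) * (- 4 * \<i>) * E_odd (1 - int 3) (\<tau> + of_real (of_int r / of_int p))
           + (\<Sum>a\<in>?A. P a) / (of_int p * \<tau>)) \<longlongrightarrow> (\<Sum>a\<in>?A. l a)) (at 0 within upper_cone c)"
    unfolding P_def l_def x_def
    by (intro E_odd_asymptotics_from_classes c cubic_cosecant_sum odd_residue_not_Int
        half_odd_residue_in_Ints_iff(1)[OF r p p_odd rp] inverse_power_series_residue) auto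
  moreover have "(\<Sum>a\<in>?A. P a) = of_real (pi ^ 4 / 3)"
    unfolding P_def using p by (intro sum_pole_defects) (simp add: x_def)
  moreover have "(\<Sum>a\<in>?A. l a) = of_real (2 * pi ^ 4 * of_int p ^ 3 * S_odd 2 r p)"
  proof -
    have "(\<Sum>a\<in>?A. l a) = (\<Sum>a\<in>?A - {p}. l a)"
      by (rule sum.mono_neutral_right) (use p in \<open>auto simp: l_def x_def\<close>)
    also have "\<dots> = (\<Sum>a\<in>?A - {p}. of_real (pi ^ 4 * ((2 * cot (x a) + 2 * cot (x a) ^ 3) / sin (y a))))"
    proof (rule sum.cong)
      fix a assume a: "a \<in> ?A - {p}"
      have s: "sin (x a) \<noteq> 0" using a sin_odd_residue_nonzero by (auto simp: x_def)
      have cot_cube: "cos t / sin t ^ 3 = cot t + cot t ^ 3" if "sin t \<noteq> 0" for t :: real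
      proof -
        have "cos t / sin t ^ 3 = cos t * (sin t ^ 2 + cos t ^ 2) / sin t ^ 3" by simp
        also have "\<dots> = cos t / sin t + (cos t / sin t) ^ 3"
          using that by (simp only: distrib_left add_divide_distrib power_divide) (simp add: power2_eq_square power3_eq_cube)
        finally show ?thesis by (simp add: cot_def)
      qed
      have "pi ^ 3 * cos (x a) / sin (x a) ^ 3 = pi ^ 3 * (cot (x a) + cot (x a) ^ 3)"
        unfolding cot_cube[OF s, symmetric] by (rule times_divide_eq_right[symmetric])
      moreover have "reg_cosecant_at_0 (\<beta> a) = of_real (2 * pi / sin (y a))"
        unfolding y_def using a by (intro reg_cosecant_residue) auto
      ultimately have "l a = of_real (2 * pi / sin (y a) * (pi ^ 3 * (cot (x a) + cot (x a) ^ 3)))"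
        by (simp only: l_def of_real_mult)
      also have "2 * pi / sin (y a) * (pi ^ 3 * (cot (x a) + cot (x a) ^ 3)) = pi ^ 4 * ((2 * cot (x a) + 2 * cot (x a) ^ 3) / sin (y a))"
        by (simp add: power_numeral_reduce distrib_left add_divide_distrib mult_ac)
      finally show "l a = of_real (pi ^ 4 * ((2 * cot (x a) + 2 * cot (x a) ^ 3) / sin (y a)))" .
    qed simp
    also have "\<dots> = of_real (pi ^ 4 * (\<Sum>a\<in>?A - {p}. (2 * cot (x a) + 2 * cot (x a) ^ 3) / sin (y a)))"
      by (simp add: sum_distrib_left)
    also have "(\<Sum>a\<in>?A - {p}. (2 * cot (x a) + 2 * cot (x a) ^ 3) / sin (y a)) =
        2 * (\<Sum>a\<in>odds_upto (p - 2). (2 * cot (x a) + 2 * cot (x a) ^ 3) / sin (y a))"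
      unfolding x_def y_def by (rule sum_odd_residue_cosecant) (simp add: cot_def)
    also have "(\<Sum>a\<in>odds_upto (p - 2). (2 * cot (x a) + 2 * cot (x a) ^ 3) / sin (y a)) = of_int p ^ 3 * S_odd 2 r p"
      using p unfolding S_odd_2_eq x_def y_def by simp
    finally show ?thesis by (simp add: mult_ac)
  qed
  ultimately show ?thesis by simp
qed

lemma S_odd_combination:
  "of_int p ^ 2 * S_odd 2 r p - 2 * S_odd 0 r p = 2 / of_int p * (\<Sum>n\<in>odds_upto (p - 2).
      cot (pi * of_int n / (2 * of_int p)) ^ 3 / sin (pi * of_int n * (of_int r / of_int p)))"
proof -
  define X where "X = (\<Sum>n\<in>odds_upto (p - 2). cot (pi * of_int n / (2 * of_int p)) / sin (pi * of_int n * (of_int r / of_int p)))"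
  define Y where "Y = (\<Sum>n\<in>odds_upto (p - 2). cot (pi * of_int n / (2 * of_int p)) ^ 3 / sin (pi * of_int n * (of_int r / of_int p)))"
  have "S_odd 0 r p = 1 / of_int p * X" by (simp add: S_odd_def X_def)
  moreover have "S_odd 2 r p = 1 / of_int p ^ 3 * (2 * X + 2 * Y)"
    unfolding S_odd_2_eq X_def Y_def by (simp add: add_divide_distrib sum.distrib sum_distrib_left)
  ultimately show ?thesis using p unfolding Y_def[symmetric]
    by (simp add: field_simps power2_eq_square power3_eq_cube)
qed

end

text \<open>
  On the sector the sine of the argument is at least \<open>sin \<epsilon>\<close>.
\<close>

lemma sector_subset_upper_cone: "sector \<epsilon> \<subseteq> upper_cone (sin \<epsilon>)" if "0 < \<epsilon>" "\<epsilon> < pi / 2"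
proof
  fix \<tau> assume "\<tau> \<in> sector \<epsilon>"
  hence \<tau>: "\<tau> \<noteq> 0" "\<epsilon> \<le> Arg \<tau>" "Arg \<tau> \<le> pi - \<epsilon>" by (auto simp: sector_def)
  have "sin \<epsilon> \<le> sin (Arg \<tau>)"
  proof (cases "Arg \<tau> \<le> pi / 2")
    case True
    thus ?thesis using \<tau> that by (intro sin_monotone_2pi_le) auto
  next
    case False
    have "sin \<epsilon> \<le> sin (pi - Arg \<tau>)" using \<tau> that False by (intro sin_monotone_2pi_le) auto
    thus ?thesis by simp
  qed
  moreover have "Im \<tau> = norm \<tau> * sin (Arg \<tau>)" using \<tau>(1) by (metis Im_rcis rcis_cmod_Arg)
  ultimately show "\<tau> \<in> upper_cone (sin \<epsilon>)" using \<tau>(1) by (simp add: upper_cone_def mult.commute mult_left_mono)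
qed

theorem theorem1p3:
  fixes r p :: int and x :: real
  assumes "odd r" and "odd p" and "coprime r p" and "1 \<le> r" and "r < p"
    and "x = real_of_int r / real_of_int p"
  shows "sigma2 r p =
           2 / real_of_int p *
             (\<Sum>n\<in>odds_upto (p - 2).
                cot (pi * real_of_int n / (2 * real_of_int p)) ^ 3 / sin (pi * real_of_int n * x))
       \<and> sigma2 r p = real_of_int p ^ 2 * S_odd 2 r p - 2 * S_odd 0 r p
       \<and> (\<forall>\<epsilon>. 0 < \<epsilon> \<and> \<epsilon> < pi / 2 \<longrightarrow>
            ((\<lambda>\<tau>. of_int p ^ 2 * (32 / (complex_of_real pi ^ 3 * \<i>)) * E_odd (-2) (\<tau> + complex_of_real x)
                  - 8 / (complex_of_real pi * \<i>) * E_odd 0 (\<tau> + complex_of_real x)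
                  - 1 / (3 * of_int p ^ 2 * \<tau>))
              \<longlongrightarrow> complex_of_real (sigma2 r p) + \<i> * complex_of_real (2 * ln 2 / pi))
            (at 0 within sector \<epsilon>))"
proof (intro conjI allI impI)
  have p: "p > 0" using assms by linarith
  note x = \<open>x = real_of_int r / real_of_int p\<close>
  show sigma2_cot: "sigma2 r p = 2 / real_of_int p * (\<Sum>n\<in>odds_upto (p - 2).
                cot (pi * real_of_int n / (2 * real_of_int p)) ^ 3 / sin (pi * real_of_int n * x))"
    unfolding x by (rule sigma2_eq_cot_cube_sum[OF assms(1) p assms(2,3)])
  show sigma2_S: "sigma2 r p = real_of_int p ^ 2 * S_odd 2 r p - 2 * S_odd 0 r p"
    unfolding S_odd_combination[OF assms(1) p assms(2,3)] using sigma2_cot unfolding x .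
  fix \<epsilon> :: real assume "0 < \<epsilon> \<and> \<epsilon> < pi / 2"
  hence \<epsilon>: "0 < \<epsilon>" "\<epsilon> < pi / 2" by auto
  hence c: "sin \<epsilon> > 0" by (intro sin_gt_zero) auto
  let ?P = "complex_of_int p" and ?\<pi> = "complex_of_real pi"
  define F1 where "F1 = (\<lambda>\<tau>. (2 * ?P) * (2 * ?\<pi>) * (- 4 * \<i>) * E_odd 0 (\<tau> + of_real x) + of_real (pi ^ 2) / (?P * \<tau>))"
  define F3 where "F3 = (\<lambda>\<tau>. (2 * ?P) ^ 3 * (2 * ?\<pi>) * (- 4 * \<i>) * E_odd (- 2) (\<tau> + of_real x) + of_real (pi ^ 4 / 3) / (?P * \<tau>))"
  have F1: "(F1 \<longlongrightarrow> of_real (4 * pi ^ 2 * of_int p * S_odd 0 r p) - \<i> * of_real (4 * pi * of_int p * ln 2)) (at 0 within upper_cone (sin \<epsilon>))"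
    unfolding F1_def x by (rule E_odd_0_asymptotics[OF assms(1) p assms(2,3) c])
  have F3: "(F3 \<longlongrightarrow> of_real (2 * pi ^ 4 * of_int p ^ 3 * S_odd 2 r p)) (at 0 within upper_cone (sin \<epsilon>))"
    unfolding F3_def x by (rule E_odd_minus_2_asymptotics[OF assms(1) p assms(2,3) c])
  have "((\<lambda>\<tau>. F3 \<tau> / (2 * ?\<pi> ^ 4 * ?P) - F1 \<tau> / (2 * ?\<pi> ^ 2 * ?P)) \<longlongrightarrow>
     of_real (2 * pi ^ 4 * of_int p ^ 3 * S_odd 2 r p) / (2 * ?\<pi> ^ 4 * ?P)
     - (of_real (4 * pi ^ 2 * of_int p * S_odd 0 r p) - \<i> * of_real (4 * pi * of_int p * ln 2)) / (2 * ?\<pi> ^ 2 * ?P)) (at 0 within upper_cone (sin \<epsilon>))"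
    using p by (intro tendsto_diff tendsto_divide F1 F3 tendsto_const) auto
  also have "of_real (2 * pi ^ 4 * of_int p ^ 3 * S_odd 2 r p) / (2 * ?\<pi> ^ 4 * ?P)
     - (of_real (4 * pi ^ 2 * of_int p * S_odd 0 r p) - \<i> * of_real (4 * pi * of_int p * ln 2)) / (2 * ?\<pi> ^ 2 * ?P)
     = complex_of_real (sigma2 r p) + \<i> * complex_of_real (2 * ln 2 / pi)"
    unfolding sigma2_S using p by (simp add: field_simps power2_eq_square power3_eq_cube)
  finally have lim: "((\<lambda>\<tau>. F3 \<tau> / (2 * ?\<pi> ^ 4 * ?P) - F1 \<tau> / (2 * ?\<pi> ^ 2 * ?P)) \<longlongrightarrow>
      complex_of_real (sigma2 r p) + \<i> * complex_of_real (2 * ln 2 / pi)) (at 0 within sector \<epsilon>)"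
    by (rule tendsto_within_subset) (rule sector_subset_upper_cone[OF \<epsilon>])
  show "((\<lambda>\<tau>. of_int p ^ 2 * (32 / (complex_of_real pi ^ 3 * \<i>)) * E_odd (-2) (\<tau> + complex_of_real x)
                  - 8 / (complex_of_real pi * \<i>) * E_odd 0 (\<tau> + complex_of_real x)
                  - 1 / (3 * of_int p ^ 2 * \<tau>))
              \<longlongrightarrow> complex_of_real (sigma2 r p) + \<i> * complex_of_real (2 * ln 2 / pi))
            (at 0 within sector \<epsilon>)"
  proof (rule Lim_transform_eventually[OF lim])
    have "F3 \<tau> / (2 * ?\<pi> ^ 4 * ?P) - F1 \<tau> / (2 * ?\<pi> ^ 2 * ?P) =
        ?P ^ 2 * (32 / (?\<pi> ^ 3 * \<i>)) * E_odd (-2) (\<tau> + of_real x)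
          - 8 / (?\<pi> * \<i>) * E_odd 0 (\<tau> + of_real x) - 1 / (3 * ?P ^ 2 * \<tau>)" if "\<tau> \<noteq> 0" for \<tau>
    proof -
      \<comment> \<open>The poles at \<open>t = 0\<close> agree because \<open>1/6 - 1/2 = - 1/3\<close>.\<close>
      have "(((2 * P) ^ 3 * (2 * q) * (- 4 * \<i>) * A + q ^ 4 / 3 / (P * t)) / (2 * q ^ 4 * P)
          - ((2 * P) * (2 * q) * (- 4 * \<i>) * B + q ^ 2 / (P * t)) / (2 * q ^ 2 * P))
          = P ^ 2 * (32 / (q ^ 3 * \<i>)) * A - 8 / (q * \<i>) * B - 1 / (3 * P ^ 2 * t)"
        if "P \<noteq> 0" "q \<noteq> 0" "t \<noteq> 0" for P q A B t :: complex
        using that by (simp add: field_simps power2_eq_square power3_eq_cube power_numeral_reduce)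
      from this[of ?P ?\<pi> \<tau> "E_odd (-2) (\<tau> + of_real x)" "E_odd 0 (\<tau> + of_real x)"] that p
      show ?thesis by (simp add: F1_def F3_def)
    qed
    thus "eventually (\<lambda>\<tau>. F3 \<tau> / (2 * ?\<pi> ^ 4 * ?P) - F1 \<tau> / (2 * ?\<pi> ^ 2 * ?P) =
        ?P ^ 2 * (32 / (?\<pi> ^ 3 * \<i>)) * E_odd (-2) (\<tau> + of_real x)
          - 8 / (?\<pi> * \<i>) * E_odd 0 (\<tau> + of_real x) - 1 / (3 * ?P ^ 2 * \<tau>)) (at 0 within sector \<epsilon>)"
      by (auto simp: eventually_at_filter)
  qed
qed

end
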